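(* Assume the following. (i) $\phi$ (and hence $l(\cdot,y)$) is differentiable and convex; there is $M>0$ with $|\partial_\zeta l(\zeta,y)|\le M$ for all $\zeta\in\mathbb{R}$, $y\in\{-1,1\}$; and $\mathcal{L}$ is $L$-smooth for some $L>0$, i.e. $|\mathcal{L}(g+h)-\mathcal{L}(g)-\langle\nabla\mathcal{L}(g),h\rangle_{\mathcal{H}_k}|\le \frac{L}{2}\|h\|_{\mathcal{H}_k}^2$ for all $g,h\in\mathcal{H}_k$. (ii) $\mathrm{supp}(\rho_{\mathcal{X}})=\mathcal{X}$ and there is $R>0$ with $k(x,x)\le R^2$ for all $x\in\mathcal{X}$. (iii) There is $\delta\in(0,1/2)$ such that $|\rho(1|x)-\frac12|>\delta$ for $\rho_{\mathcal{X}}$-almost every $x$. (iv) $\rho(1|X)\in(0,1)$ $\rho_{\mathcal{X}}$-almost surely; the link function $h_*$ is well-defined, differentiable, monotonically increasing and invertible over $(0,1)$; and $\mathrm{sgn}(\mu-1/2)=\mathrm{sgn}(h_*(\mu))$ for $\mu\in(0,1)$. (v) The Bregman divergence $d_{l_*}$ is positive, i.e. $d_{l_*}(\eta_1,\eta_2)=0$ if and only if $\eta_1=\eta_2$; and a Bayes rule $g_*$ for $\mathcal{L}$, unique up to $\rho_{\mathcal{X}}$-null sets, exists in $\mathcal{H}_k$. Then there exists a sufficiently small $\lambda>0$ such that the following holds. Run stochastic gradient descent (without averaging) on $\mathcal{L}_\lambda$ with $\eta_t=\frac{2}{\lambda(\gamma+t)}$, where $\gamma>0$ is such that $\eta_1\le\min\{\frac{1}{L+\lambda},\frac{1}{2\lambda}\}$.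 Let $\sigma^2>0$ be an upper bound on the variance of the stochastic gradient $\partial_\zeta l(g(X),Y)k(X,\cdot)$, and assume $\|g_1\|_{\mathcal{H}_k}\le(2\eta_1+\frac1\lambda)MR$. Set $$\nu=\max\left\{\frac{2}{\lambda^2}(L+\lambda)\sigma^2,\ (1+\gamma)\big(\mathcal{L}_\lambda(g_1)-\mathcal{L}_\lambda(g_\lambda)\big)\right\}.$$ Then for every $T\ge\frac{32R^2\nu}{m^2(\delta)\lambda}-\gamma$, $$\mathbb{E}\big[\mathcal{R}(g_{T+1})-\mathcal{R}(\mathbb{E}[Y|x])\big]\le 2\exp\left(-\frac{m^2(\delta)\lambda^2(\gamma+T)}{2^9\cdot 9\,M^2R^4}\right),$$ where the outer expectation is over the samples $z_1,\dots,z_T$.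
   Context: Setting: $\mathcal{X}$ is a measurable feature space (with a topology for which the support of a measure makes sense), $\mathcal{Y}=\{-1,1\}$, $\rho$ is a probability measure on $\mathcal{X}\times\mathcal{Y}$ with marginal $\rho_{\mathcal{X}}$ on $\mathcal{X}$ and conditional distribution $\rho(\cdot|x)$ on $\mathcal{Y}$; $Z=(X,Y)\sim\rho$. $\mathcal{H}_k$ is the reproducing kernel Hilbert space of a real-valued kernel $k$ on $\mathcal{X}$, with inner product $\langle\cdot,\cdot\rangle_{\mathcal{H}_k}$ and norm $\|\cdot\|_{\mathcal{H}_k}$. Loss: $\phi:\mathbb{R}\to\mathbb{R}$ is a non-negative convex function and $l(\zeta,y)=\phi(y\zeta)$; $\partial_\zeta l$ is the derivative in the first variable. Risks: $\mathcal{L}(g)=\mathbb{E}[l(g(X),Y)]$ and $\mathcal{L}_\lambda(g)=\mathcal{L}(g)+\frac{\lambda}{2}\|g\|_{\mathcal{H}_k}^2$; $\nabla$ is the gradient in $\mathcal{H}_k$; $g_\lambda$ is the minimizer of $\mathcal{L}_\lambda$ over $\mathcal{H}_k$. A Bayes rule $g_*$ for $\mathcal{L}$ is a minimizer of $\mathcal{L}$ over all measurable functions $\mathcal{X}\to\mathbb{R}$. Expected classification error: $\mathcal{R}(g)=\mathbb{E}_{(X,Y)\sim\rho}[I(\mathrm{sgn}(g(X)),Y)]$, where $I(y,y')=1$ if $y\ne y'$ and $0$ if $y=y'$. $\mathcal{R}(\mathbb{E}[Y|x])$ denotes $\mathcal{R}$ of the function $x\mapsto\mathbb{E}[Y|x]=2\rho(1|x)-1$,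 which minimizes $\mathcal{R}$ over all measurable functions. For $\mu\in(0,1)$: $h_*(\mu)=\arg\min_{h\in\mathbb{R}}\{\mu\phi(h)+(1-\mu)\phi(-h)\}$ (the link function) and $l_*(\mu)=\min_{h\in\mathbb{R}}\{\mu\phi(h)+(1-\mu)\phi(-h)\}$, which is concave. $d_{l_*}(\eta_1,\eta_2)=-l_*(\eta_2)+l_*(\eta_1)+l_*'(\eta_1)(\eta_2-\eta_1)$. $m(\delta)=\min\{h_*(0.5+\delta),|h_*(0.5-\delta)|\}$. Stochastic gradient descent (without averaging): $G_\lambda(g,z)=\partial_\zeta l(g(x),y)k(x,\cdot)+\lambda g$ for $z=(x,y)$. From a (deterministic) initial function $g_1\in\mathcal{H}_k$, for $t=1,\dots,T$ draw $z_t=(x_t,y_t)\sim\rho$ independently and set $g_{t+1}=g_t-\eta_tG_\lambda(g_t,z_t)$; the output is $g_{T+1}$. The variance of the stochastic gradient at $g$ is $\mathbb{E}\|\partial_\zeta l(g(X),Y)k(X,\cdot)-\nabla\mathcal{L}(g)\|_{\mathcal{H}_k}^2$. *)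

theory Defs
  imports "HOL-Probability.Probability"
begin

text \<open>
  Throughout, \<open>A\<close> is the measurable space of features, labels are the reals \<open>-1\<close> and \<open>1\<close>, and
  \<open>\<rho>\<close> is a measure on \<open>A \<Otimes>\<^sub>M label_space\<close>.
\<close>

definition label_space :: "real measure" where
  "label_space = count_space {-1, 1}"

definition marginal :: "'x measure \<Rightarrow> ('x \<times> real) measure \<Rightarrow> 'x measure" where
  "marginal A \<rho> = distr \<rho> A fst"

text \<open>\<open>\<kappa> x\<close> is (a version of) the conditional distribution \<open>\<rho>(\<cdot>|x)\<close>.\<close>

definition conditional_distribution ::
    "'x measure \<Rightarrow> ('x \<times> real) measure \<Rightarrow> ('x \<Rightarrow> real measure) \<Rightarrow> bool" where
  "conditional_distribution A \<rho> \<kappa> \<longleftrightarrow>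
     \<kappa> \<in> A \<rightarrow>\<^sub>M prob_algebra label_space \<and>
     (\<forall>B\<in>sets A. \<forall>C\<in>sets label_space.
        emeasure \<rho> (B \<times> C) = (\<integral>\<^sup>+x\<in>B. emeasure (\<kappa> x) C \<partial>marginal A \<rho>))"

definition measure_support :: "'x::topological_space measure \<Rightarrow> 'x set" where
  "measure_support \<mu> = {x. \<forall>U. open U \<and> x \<in> U \<longrightarrow> 0 < emeasure \<mu> U}"

text \<open>
  The reproducing kernel Hilbert space of \<open>k\<close> is a Hilbert space type \<open>'h\<close> whose elements are
  identified with functions by the injective map \<open>eval_at\<close>: \<open>eval_at g\<close> is the function \<open>g\<close>, and
  \<open>kernel_section eval_at k x\<close> is \<open>k(x,\<cdot>)\<close> viewed as an element of \<open>'h\<close>. Linearity of \<open>eval_at\<close>, symmetry and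
  positive definiteness of \<open>k\<close> follow from the reproducing property.
\<close>

definition kernel_section :: "('h \<Rightarrow> 'x \<Rightarrow> real) \<Rightarrow> ('x \<Rightarrow> 'x \<Rightarrow> real) \<Rightarrow> 'x \<Rightarrow> 'h" where
  "kernel_section eval_at k x = inv eval_at (k x)"

definition is_rkhs ::
    "('x \<Rightarrow> 'x \<Rightarrow> real) \<Rightarrow> ('h::{real_inner,complete_space} \<Rightarrow> 'x \<Rightarrow> real) \<Rightarrow> bool" where
  "is_rkhs k eval_at \<longleftrightarrow>
     inj eval_at \<and> (\<forall>x. k x \<in> range eval_at) \<and> (\<forall>g x. eval_at g x = inner g (kernel_section eval_at k x))"

definition gradient :: "('h::real_inner \<Rightarrow> real) \<Rightarrow> 'h \<Rightarrow> 'h" where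
  "gradient f g = (THE D. GDERIV f g :> D)"

definition loss :: "(real \<Rightarrow> real) \<Rightarrow> real \<Rightarrow> real \<Rightarrow> real" where
  "loss \<phi> \<zeta> y = \<phi> (y * \<zeta>)"

definition dloss :: "(real \<Rightarrow> real) \<Rightarrow> real \<Rightarrow> real \<Rightarrow> real" where
  "dloss \<phi> \<zeta> y = deriv (\<lambda>u. loss \<phi> u y) \<zeta>"

definition risk :: "(real \<Rightarrow> real) \<Rightarrow> ('x \<times> real) measure \<Rightarrow> ('x \<Rightarrow> real) \<Rightarrow> real" where
  "risk \<phi> \<rho> f = (\<integral>z. loss \<phi> (f (fst z)) (snd z) \<partial>\<rho>)"

definition reg_risk ::
    "(real \<Rightarrow> real) \<Rightarrow> ('x \<times> real) measure \<Rightarrow> ('h::real_inner \<Rightarrow> 'x \<Rightarrow> real) \<Rightarrow> real \<Rightarrow> 'h \<Rightarrow> real" where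
  "reg_risk \<phi> \<rho> eval_at lam g = risk \<phi> \<rho> (eval_at g) + lam / 2 * (norm g)\<^sup>2"

text \<open>
  The loss is non-negative, so a measurable function with non-integrable loss has infinite risk;
  since the Bochner integral assigns it the value 0 instead, such functions are excluded explicitly.
  They are never minimizers, because constant functions have finite risk.
\<close>

definition bayes_rule ::
    "'x measure \<Rightarrow> (real \<Rightarrow> real) \<Rightarrow> ('x \<times> real) measure \<Rightarrow> ('x \<Rightarrow> real) \<Rightarrow> bool" where
  "bayes_rule A \<phi> \<rho> =
     is_arg_min (risk \<phi> \<rho>)
       (\<lambda>f. f \<in> borel_measurable A \<and> integrable \<rho> (\<lambda>z. loss \<phi> (f (fst z)) (snd z)))"

text \<open>Since \<open>sgn 0 = 0\<close>, a vanishing prediction counts as an error for either label.\<close>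

definition class_error :: "('x \<times> real) measure \<Rightarrow> ('x \<Rightarrow> real) \<Rightarrow> real" where
  "class_error \<rho> f = (\<integral>z. of_bool (sgn (f (fst z)) \<noteq> snd z) \<partial>\<rho>)"

definition cond_risk :: "(real \<Rightarrow> real) \<Rightarrow> real \<Rightarrow> real \<Rightarrow> real" where
  "cond_risk \<phi> \<mu> h = \<mu> * \<phi> h + (1 - \<mu>) * \<phi> (- h)"

definition link :: "(real \<Rightarrow> real) \<Rightarrow> real \<Rightarrow> real" where
  "link \<phi> \<mu> = arg_min (cond_risk \<phi> \<mu>) (\<lambda>_. True)"

definition link_well_defined :: "(real \<Rightarrow> real) \<Rightarrow> bool" where
  "link_well_defined \<phi> \<longleftrightarrow>
     (\<forall>\<mu>\<in>{0<..<1}. \<exists>!h. is_arg_min (cond_risk \<phi> \<mu>) (\<lambda>_. True) h)"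

definition min_cond_risk :: "(real \<Rightarrow> real) \<Rightarrow> real \<Rightarrow> real" where
  "min_cond_risk \<phi> \<mu> = (INF h. cond_risk \<phi> \<mu> h)"

text \<open>The Bregman divergence of the concave function \<open>l\<close>.\<close>

definition bregman :: "(real \<Rightarrow> real) \<Rightarrow> real \<Rightarrow> real \<Rightarrow> real" where
  "bregman l a b = - l b + l a + deriv l a * (b - a)"

definition margin :: "(real \<Rightarrow> real) \<Rightarrow> real \<Rightarrow> real" where
  "margin \<phi> \<delta> = min (link \<phi> (1/2 + \<delta>)) \<bar>link \<phi> (1/2 - \<delta>)\<bar>"

definition stoch_grad ::
    "(real \<Rightarrow> real) \<Rightarrow> ('h::real_inner \<Rightarrow> 'x \<Rightarrow> real) \<Rightarrow> ('x \<Rightarrow> 'x \<Rightarrow> real) \<Rightarrow> 'h \<Rightarrow> 'x \<times> real \<Rightarrow> 'h" where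
  "stoch_grad \<phi> eval_at k g z = dloss \<phi> (eval_at g (fst z)) (snd z) *\<^sub>R kernel_section eval_at k (fst z)"

definition step_size :: "real \<Rightarrow> real \<Rightarrow> nat \<Rightarrow> real" where
  "step_size lam \<gamma> t = 2 / (lam * (\<gamma> + real t))"

text \<open>\<open>sgd \<phi> eval_at k lam \<eta> g1 z n\<close> is the iterate with index \<open>n + 1\<close>; it depends on \<open>z 1, \<dots>, z n\<close>.\<close>

primrec sgd ::
    "(real \<Rightarrow> real) \<Rightarrow> ('h::real_inner \<Rightarrow> 'x \<Rightarrow> real) \<Rightarrow> ('x \<Rightarrow> 'x \<Rightarrow> real) \<Rightarrow> real \<Rightarrow> (nat \<Rightarrow> real) \<Rightarrow>
     'h \<Rightarrow> (nat \<Rightarrow> 'x \<times> real) \<Rightarrow> nat \<Rightarrow> 'h" where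
  "sgd \<phi> eval_at k lam \<eta> g1 z 0 = g1"
| "sgd \<phi> eval_at k lam \<eta> g1 z (Suc n) =
     sgd \<phi> eval_at k lam \<eta> g1 z n
     - \<eta> (Suc n) *\<^sub>R (stoch_grad \<phi> eval_at k (sgd \<phi> eval_at k lam \<eta> g1 z n) (z (Suc n))
                       + lam *\<^sub>R sgd \<phi> eval_at k lam \<eta> g1 z n)"

end

theory Submission
  imports Defs
begin

text \<open>
  Write \<open>e t\<close> for the difference between the SGD iterate and the minimiser of the regularised risk.
  One step splits into a deterministic gradient step, which contracts \<open>e t\<close> by the factor
  \<open>1 - \<eta> t * lam\<close> because the gradient of a convex smooth function is cocoercive, and a bounded noise term of
  mean zero. Since \<open>cosh \<circ> sqrt\<close> is convex, adding bounded mean-zero noise to a vector multiplies the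
  expectation of \<open>cosh (\<theta> * norm _)\<close> by at most a Gaussian factor. Iterating over the steps bounds
  \<open>cosh (\<theta> * norm (e T))\<close> in expectation, and Markov's inequality with the optimal \<open>\<theta>\<close> gives the
  exponential tail. Working with \<open>e t\<close> itself, rather than with the Doob martingale of the last
  iterate, avoids a pathwise stability estimate, which would need the loss itself to be smooth.

  The regularisation path converges in norm to a minimiser of the risk. By uniqueness of the Bayes rule this
  limit agrees almost surely with the link function of the conditional probability, hence stays away from zero by
  the margin. For small \<open>lam\<close>, every function within \<open>margin / (2 * R)\<close> of the regularised minimiser therefore has
  the optimal signs almost surely.
\<close>

section \<open>A martingale step in Hilbert space\<close>

text \<open>Only even powers occur in the series of \<open>cosh\<close>, so in \<open>w\<close> it
  is a power series with nonnegative coefficients. Convexity and the Gaussian bound below are both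
  read off term by term.\<close>

lemma cosh_sqrt_sums:
  fixes w :: real
  assumes "0 \<le> w"
  shows "(\<lambda>n. w ^ n / fact (2 * n)) sums cosh (sqrt w)"
proof -
  have "(\<lambda>n. if even n then sqrt w ^ n /\<^sub>R fact n else 0) sums cosh (sqrt w)"
    by (rule cosh_converges)
  then have "(\<lambda>n. if even (2 * n) then sqrt w ^ (2 * n) /\<^sub>R fact (2 * n) else 0) sums cosh (sqrt w)"
    by (subst sums_mono_reindex[where g = "\<lambda>n. 2 * n"]) (auto simp: strict_mono_def elim!: evenE)
  then show ?thesis
    using assms by (simp only: power_mult real_sqrt_pow2) (simp add: divide_inverse mult.commute)
qed

text \<open>Each term of the series is convex on the half-line, and termwise inequalities survive
  summation.\<close>

lemma cosh_sqrt_convex: "convex_on {0..} (\<lambda>w::real. cosh (sqrt w))"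
proof (rule convex_onI)
  fix t x y :: real
  assume t: "0 < t" "t < 1" and xy: "x \<in> {0..}" "y \<in> {0..}"
  have conv: "convex_on {0..} (\<lambda>w::real. w ^ n)" for n
    by (cases "even n") (auto intro: convex_power_odd convex_on_subset[OF convex_power_even])
  have "((1 - t) * x + t * y) ^ n / fact (2 * n) \<le> (1 - t) * (x ^ n / fact (2 * n)) + t * (y ^ n / fact (2 * n))" for n
    using convex_onD[OF conv[of n], of t x y] t xy by (simp add: divide_right_mono flip: add_divide_distrib)
  moreover have "(\<lambda>n. ((1 - t) * x + t * y) ^ n / fact (2 * n)) sums cosh (sqrt ((1 - t) * x + t * y))"
    using t xy by (intro cosh_sqrt_sums) auto
  moreover have "(\<lambda>n. (1 - t) * (x ^ n / fact (2 * n)) + t * (y ^ n / fact (2 * n)))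
      sums ((1 - t) * cosh (sqrt x) + t * cosh (sqrt y))"
    using xy by (intro sums_add sums_mult cosh_sqrt_sums) auto
  ultimately show "cosh (sqrt ((1 - t) *\<^sub>R x + t *\<^sub>R y)) \<le> (1 - t) * cosh (sqrt x) + t * cosh (sqrt y)"
    unfolding real_scaleR_def by (rule sums_le)
qed simp

text \<open>With \<open>norm d\<close> replaced by \<open>b\<close>, the squared norm of
  \<open>x + d\<close> is a convex combination of the squares of \<open>r - b\<close> and
  \<open>r + b\<close>. Convexity of \<open>cosh\<close> after \<open>sqrt\<close> then gives a
  bound affine in \<open>d\<close>, whose linear part vanishes in expectation. For
  \<open>x = 0\<close> the quotient is \<open>0\<close> by convention.\<close>

lemma cosh_norm_add_le:
  fixes x d :: "'a::real_inner"
  assumes "0 < b" "norm d \<le> b"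
  shows "cosh (norm (x + d)) \<le>
    cosh (norm x) * cosh b + inner x d * (sinh (norm x) * sinh b / (norm x * b))"
proof (cases "x = 0")
  case True
  then show ?thesis
    using assms cosh_real_nonneg_le_iff[of "norm d" b] by simp
next
  case False
  define r where "r = norm x"
  define p where "p = inner x d / r"
  have r: "r > 0" using False by (simp add: r_def)
  have p: "inner x d = r * p" using r by (simp add: p_def)
  have "\<bar>inner x d\<bar> \<le> r * b"
    using Cauchy_Schwarz_ineq2[of x d] mult_left_mono[OF assms(2), of "norm x"] by (simp add: r_def)
  then have "r * \<bar>p\<bar> \<le> r * b"
    using r by (simp add: p abs_mult)
  then have "\<bar>p\<bar> \<le> b"
    using r by (simp only: mult_le_cancel_left_pos)
  then have pb: "- b \<le> p" "p \<le> b"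
    by linarith+
  \<comment> \<open>\<open>t\<close> is the weight that writes \<open>p\<close> as a mixture of
    \<open>- b\<close> and \<open>b\<close>.\<close>
  define t where "t = (1 + p / b) / 2"
  have t: "0 \<le> t" "t \<le> 1"
    using pb assms(1) pos_le_divide_eq[of b "-1" p] pos_divide_le_eq[of b p 1] by (simp_all add: t_def)
  have pt: "p = (2 * t - 1) * b"
    using assms(1) by (simp add: t_def field_simps)
  have "(norm (x + d))\<^sup>2 = r\<^sup>2 + 2 * r * p + (norm d)\<^sup>2"
    using p by (simp add: power2_norm_eq_inner inner_add r_def inner_commute)
  also have "\<dots> \<le> r\<^sup>2 + 2 * r * p + b\<^sup>2"
    using assms by (simp add: power_mono)
  also have "\<dots> = (1 - t) * (r - b)\<^sup>2 + t * (r + b)\<^sup>2"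
    unfolding pt by (simp add: algebra_simps power2_eq_square)
  finally have le: "norm (x + d) \<le> sqrt ((1 - t) * (r - b)\<^sup>2 + t * (r + b)\<^sup>2)"
    by (rule real_le_rsqrt)
  have "cosh (norm (x + d)) \<le> cosh (sqrt ((1 - t) * (r - b)\<^sup>2 + t * (r + b)\<^sup>2))"
    using le by (subst cosh_real_nonneg_le_iff) (use order_trans[OF norm_ge_zero le] in simp_all)
  also have "\<dots> \<le> (1 - t) * cosh (r - b) + t * cosh (r + b)"
    using convex_onD[OF cosh_sqrt_convex, of t "(r - b)\<^sup>2" "(r + b)\<^sup>2"] t by simp
  also have "\<dots> = cosh r * cosh b + (2 * t - 1) * (sinh r * sinh b)"
    by (simp add: cosh_add cosh_diff algebra_simps)
  also have "(2 * t - 1) * (sinh r * sinh b) = inner x d * (sinh r * sinh b / (r * b))"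
    using r assms(1) by (simp add: p pt)
  finally show ?thesis
    by (simp add: r_def)
qed

text \<open>Termwise comparison of the two series, which reduces to
  \<open>2 ^ n * fact n \<le> fact (2 * n)\<close>.\<close>

lemma cosh_le_exp_half_square:
  fixes b :: real
  shows "cosh b \<le> exp (b\<^sup>2 / 2)"
proof -
  have fact: "2 ^ n * fact n \<le> (fact (2 * n) :: real)" for n
  proof (induction n)
    case (Suc n)
    have "2 ^ Suc n * fact (Suc n) = (2 * real n + 2) * (2 ^ n * fact n)"
      by (simp add: algebra_simps)
    also have "\<dots> \<le> (2 * real n + 2) * ((2 * real n + 1) * fact (2 * n))"
      using Suc by (intro mult_left_mono order_trans[OF Suc]) (auto simp: mult_le_cancel_right1)
    also have "\<dots> = fact (2 * Suc n)"
      by (simp add: algebra_simps)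
    finally show ?case .
  qed simp
  have "(b\<^sup>2) ^ n / fact (2 * n) \<le> (b\<^sup>2 / 2) ^ n /\<^sub>R fact n" for n
  proof -
    have "(b\<^sup>2) ^ n / fact (2 * n) \<le> (b\<^sup>2) ^ n / (2 ^ n * fact n)"
      using fact[of n] by (intro divide_left_mono) auto
    also have "\<dots> = (b\<^sup>2 / 2) ^ n /\<^sub>R fact n"
      unfolding power_divide by (simp add: field_simps)
    finally show ?thesis .
  qed
  moreover have "(\<lambda>n. (b\<^sup>2) ^ n / fact (2 * n)) sums cosh \<bar>b\<bar>"
    using cosh_sqrt_sums[of "b\<^sup>2"] by simp
  moreover have "(\<lambda>n. (b\<^sup>2 / 2) ^ n /\<^sub>R fact n) sums exp (b\<^sup>2 / 2)"
    by (rule exp_converges)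
  ultimately show ?thesis
    unfolding cosh_real_abs by (rule sums_le)
qed

text \<open>The martingale step of Pinelis' inequality in Hilbert space.\<close>

lemma (in prob_space) nn_integral_cosh_norm_le:
  fixes v :: "'b::real_inner"
  assumes b: "0 < b" "\<And>\<omega>. \<omega> \<in> space M \<Longrightarrow> norm (d \<omega>) \<le> b"
    and int: "integrable M (\<lambda>\<omega>. inner v (d \<omega>))"
    and mean: "(\<integral>\<omega>. inner v (d \<omega>) \<partial>M) = 0"
  shows "(\<integral>\<^sup>+\<omega>. ennreal (cosh (norm (v + d \<omega>))) \<partial>M) \<le> ennreal (cosh (norm v) * exp (b\<^sup>2 / 2))"
proof -
  define c where "c = sinh (norm v) * sinh b / (norm v * b)"
  have le: "cosh (norm (v + d \<omega>)) \<le> cosh (norm v) * cosh b + inner v (d \<omega>) * c" if "\<omega> \<in> space M" for \<omega>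
    unfolding c_def by (rule cosh_norm_add_le[OF b(1) b(2)[OF that]])
  \<comment> \<open>The nonnegative integral is monotone for arbitrary functions, so measurability
    matters only for the affine majorant. The majorant is nonnegative because it dominates
    \<open>cosh\<close>.\<close>
  have "(\<integral>\<^sup>+\<omega>. ennreal (cosh (norm (v + d \<omega>))) \<partial>M)
      \<le> (\<integral>\<^sup>+\<omega>. ennreal (cosh (norm v) * cosh b + inner v (d \<omega>) * c) \<partial>M)"
    by (intro nn_integral_mono ennreal_leI le)
  also have "\<dots> = ennreal (\<integral>\<omega>. cosh (norm v) * cosh b + inner v (d \<omega>) * c \<partial>M)"
    using int by (intro nn_integral_eq_integral AE_I2 order_trans[OF _ le]) auto
  also have "(\<integral>\<omega>. cosh (norm v) * cosh b + inner v (d \<omega>) * c \<partial>M) = cosh (norm v) * cosh b"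
    using int mean by (simp add: prob_space)
  also have "ennreal \<dots> \<le> ennreal (cosh (norm v) * exp (b\<^sup>2 / 2))"
    by (intro ennreal_leI mult_left_mono cosh_le_exp_half_square) simp
  finally show ?thesis .
qed

section \<open>Convex smooth risks on a reproducing kernel Hilbert space\<close>

locale rkhs =
  fixes A :: "'x measure"
    and k :: "'x \<Rightarrow> 'x \<Rightarrow> real"
    and eval_at :: "'h::{real_inner,complete_space} \<Rightarrow> 'x \<Rightarrow> real"
  assumes space_A: "space A = UNIV"
    and rkhs: "is_rkhs k eval_at"
    and k_meas[measurable]: "case_prod k \<in> borel_measurable (A \<Otimes>\<^sub>M A)"
begin

abbreviation section_at :: "'x \<Rightarrow> 'h" where
  "section_at \<equiv> kernel_section eval_at k"

lemma eval_at_inner: "eval_at g x = inner g (section_at x)"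
  using rkhs by (simp add: is_rkhs_def)

lemma eval_at_section: "eval_at (section_at x) = k x"
  using rkhs by (simp add: is_rkhs_def kernel_section_def f_inv_into_f)

lemma inner_section: "inner (section_at x) (section_at y) = k x y"
  by (simp add: eval_at_section flip: eval_at_inner)

section \<open>Measurability of the functions in the RKHS\<close>

lemma eval_at_span_measurable:
  assumes "v \<in> span (range section_at)"
  shows "eval_at v \<in> borel_measurable A"
proof (rule span_induct[OF assms])
  have "eval_at 0 = (\<lambda>x. 0)" "eval_at (u + v) = (\<lambda>x. eval_at u x + eval_at v x)"
    "eval_at (c *\<^sub>R u) = (\<lambda>x. c * eval_at u x)" for u v c
    by (auto simp: eval_at_inner inner_add_left)
  then show "subspace {v. eval_at v \<in> borel_measurable A}"
    by (simp add: subspace_def)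
next
  fix v assume "v \<in> range section_at"
  then obtain x where "v = section_at x" by blast
  then show "eval_at v \<in> borel_measurable A"
    using space_A by (simp add: eval_at_section)
qed

text \<open>
  Distance-minimising sequences in the span of the kernel sections converge to \<open>g\<close> weakly against
  the sections, so no orthogonal projection is needed.
\<close>

lemma eval_at_measurable[measurable]: "eval_at g \<in> borel_measurable A"
proof -
  define S where "S = span (range section_at)"
  define d where "d = (INF v\<in>S. (norm (g - v))\<^sup>2)"
  have bdd: "bdd_below ((\<lambda>v. (norm (g - v))\<^sup>2) ` S)"
    by (rule bdd_belowI[of _ 0]) auto
  have "0 \<in> S"
    by (simp add: S_def span_zero)
  have "\<exists>v\<in>S. (norm (g - v))\<^sup>2 < d + 1 / real (Suc n)" for n
    using cINF_less_iff[OF _ bdd, of "d + 1 / real (Suc n)"] \<open>0 \<in> S\<close> by (auto simp: d_def)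
  then obtain v where v: "\<And>n. v n \<in> S" "\<And>n. (norm (g - v n))\<^sup>2 < d + 1 / real (Suc n)"
    by metis
  \<comment> \<open>Moving the near-minimiser \<open>v n\<close> along \<open>u\<close> stays in the
    span and cannot push the squared distance below \<open>d\<close>, so \<open>g - v n\<close> is
    almost orthogonal to \<open>u\<close>.\<close>
  have bound: "(inner (g - v n) u)\<^sup>2 \<le> (1 / real (Suc n)) * (norm u)\<^sup>2" if "u \<in> S" for n u
  proof (cases "u = 0")
    case False
    define w where "w = g - v n"
    \<comment> \<open>The optimal step along \<open>u\<close>; it lowers the squared distance by
      \<open>(inner w u)\<^sup>2 / (norm u)\<^sup>2\<close>.\<close>
    define t where "t = inner w u / (norm u)\<^sup>2"
    have nu: "(norm u)\<^sup>2 > 0" using False by simp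
    have "v n + t *\<^sub>R u \<in> S"
      using v(1) that by (simp add: S_def span_add span_scale)
    then have "d \<le> (norm (w - t *\<^sub>R u))\<^sup>2"
      unfolding d_def w_def using cINF_lower[OF bdd] by (simp add: diff_diff_eq)
    also have "\<dots> = (norm w)\<^sup>2 - 2 * t * inner w u + t\<^sup>2 * (norm u)\<^sup>2"
      unfolding power2_norm_eq_inner by (simp add: inner_diff inner_commute algebra_simps power2_eq_square)
    also have "\<dots> = (norm w)\<^sup>2 - (inner w u)\<^sup>2 / (norm u)\<^sup>2"
      using nu by (simp add: t_def field_simps power2_eq_square)
    finally have "(inner w u)\<^sup>2 / (norm u)\<^sup>2 \<le> 1 / real (Suc n)"
      using v(2)[of n] by (simp add: w_def)
    then show ?thesis
      using nu by (simp only: pos_divide_le_eq w_def)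
  qed simp
  have "(\<lambda>n. eval_at (v n) x) \<longlonglongrightarrow> eval_at g x" for x
  proof -
    have "(\<lambda>n. (1 / real (Suc n)) * (norm (section_at x))\<^sup>2) \<longlonglongrightarrow> 0"
      using tendsto_mult_left_zero[OF LIMSEQ_inverse_real_of_nat] by (simp add: inverse_eq_divide)
    then have "(\<lambda>n. (inner (g - v n) (section_at x))\<^sup>2) \<longlonglongrightarrow> 0"
      by (rule tendsto_sandwich[OF _ _ tendsto_const, rotated 2])
        (use bound[of "section_at x"] in \<open>auto simp: S_def span_base intro!: always_eventually\<close>)
    then have "(\<lambda>n. inner (g - v n) (section_at x)) \<longlonglongrightarrow> 0"
      using tendsto_real_sqrt[of "\<lambda>n. (inner (g - v n) (section_at x))\<^sup>2" 0]
      by (simp add: tendsto_rabs_zero_iff)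
    then have "(\<lambda>n. eval_at g x - eval_at (v n) x) \<longlonglongrightarrow> 0"
      by (simp add: eval_at_inner inner_diff_left)
    then show ?thesis
      using tendsto_diff[OF tendsto_const[of "eval_at g x"]] by fastforce
  qed
  moreover have "eval_at (v n) \<in> borel_measurable A" for n
    using v(1)[of n] unfolding S_def by (rule eval_at_span_measurable)
  ultimately show ?thesis
    by (rule borel_measurable_LIMSEQ_real)
qed

end

locale smooth_risk = rkhs A k eval_at + prob_space \<rho>
  for A :: "'x measure" and k and eval_at :: "'h::{real_inner,complete_space} \<Rightarrow> 'x \<Rightarrow> real"
    and \<rho> :: "('x \<times> real) measure" +
  fixes \<phi> :: "real \<Rightarrow> real" and M L R :: real
  assumes sets_rho: "sets \<rho> = sets (A \<Otimes>\<^sub>M label_space)"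
    and phi_convex: "convex_on UNIV \<phi>"
    and phi_diff: "\<And>u. \<phi> differentiable at u"
    and M_pos: "0 < M"
    and dloss_bound: "\<And>\<zeta> y. y \<in> {-1, 1} \<Longrightarrow> \<bar>dloss \<phi> \<zeta> y\<bar> \<le> M"
    and L_pos: "0 < L"
    and smooth: "\<And>g h. \<bar>risk \<phi> \<rho> (eval_at (g + h)) - risk \<phi> \<rho> (eval_at g)
                    - inner (gradient (\<lambda>f. risk \<phi> \<rho> (eval_at f)) g) h\<bar> \<le> L / 2 * (norm h)\<^sup>2"
    and R_pos: "0 < R"
    and k_bound: "\<And>x. k x x \<le> R\<^sup>2"
begin

abbreviation rsk :: "'h \<Rightarrow> real" where
  "rsk g \<equiv> risk \<phi> \<rho> (eval_at g)"

abbreviation grad :: "'h \<Rightarrow> 'h" where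
  "grad \<equiv> gradient rsk"

abbreviation sgrad :: "'h \<Rightarrow> 'x \<times> real \<Rightarrow> 'h" where
  "sgrad \<equiv> stoch_grad \<phi> eval_at k"

section \<open>The loss and the stochastic gradient\<close>

lemma phi_deriv: "(\<phi> has_real_derivative deriv \<phi> u) (at u)"
  using phi_diff by (simp add: DERIV_deriv_iff_real_differentiable)

lemma dloss_eq: "dloss \<phi> \<zeta> y = y * deriv \<phi> (y * \<zeta>)"
proof -
  have "((\<lambda>u. \<phi> (y * u)) has_real_derivative deriv \<phi> (y * \<zeta>) * y) (at \<zeta>)"
    by (rule DERIV_chain2[OF phi_deriv]) (auto intro!: derivative_eq_intros)
  then show ?thesis
    by (simp add: dloss_def loss_def DERIV_imp_deriv mult.commute)
qed

lemma deriv_bound: "\<bar>deriv \<phi> u\<bar> \<le> M"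
  using dloss_bound[of 1 u] by (simp add: dloss_eq)

lemma phi_tangent: "deriv \<phi> u * (v - u) \<le> \<phi> v - \<phi> u"
  by (rule convex_on_imp_above_tangent[OF phi_convex]) (auto intro: phi_deriv)

text \<open>Adding the tangent inequalities at two points makes the derivative of a convex function
  monotone, hence Borel.\<close>

lemma deriv_phi_measurable[measurable]: "deriv \<phi> \<in> borel_measurable borel"
proof (intro borel_measurable_mono monoI)
  fix x y :: real assume "x \<le> y"
  show "deriv \<phi> x \<le> deriv \<phi> y"
  proof (cases "x = y")
    case False
    have "deriv \<phi> x * (y - x) \<le> deriv \<phi> y * (y - x)"
      using phi_tangent[of x y] phi_tangent[of y x] by (simp add: algebra_simps)
    then show ?thesis
      using False \<open>x \<le> y\<close> by simp
  qed simp
qed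

lemma phi_measurable[measurable]: "\<phi> \<in> borel_measurable borel"
  using phi_diff by (intro borel_measurable_continuous_onI continuous_at_imp_continuous_on ballI
      differentiable_imp_continuous_within)

text \<open>Tangents at \<open>0\<close> and at \<open>u\<close> control the increment from both
  sides. Linear growth makes the loss integrable for RKHS functions, which are bounded.\<close>

lemma phi_growth: "\<bar>\<phi> u\<bar> \<le> \<bar>\<phi> 0\<bar> + M * \<bar>u\<bar>"
proof -
  have le: "\<bar>deriv \<phi> v * w\<bar> \<le> M * \<bar>w\<bar>" for v w
    unfolding abs_mult by (intro mult_right_mono deriv_bound) simp
  show ?thesis
    using phi_tangent[of 0 u] phi_tangent[of u 0] le[of 0 u] le[of u u] by auto
qed

lemma space_rho: "z \<in> space \<rho> \<Longrightarrow> snd z \<in> {-1, 1}"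
  unfolding sets_eq_imp_space_eq[OF sets_rho] space_pair_measure label_space_def space_count_space mem_Times_iff
  by (rule conjunct2)

lemma fst_measurable[measurable]: "fst \<in> \<rho> \<rightarrow>\<^sub>M A"
  unfolding measurable_cong_sets[OF sets_rho refl] by simp

lemma snd_measurable_label[measurable]: "snd \<in> \<rho> \<rightarrow>\<^sub>M label_space"
  unfolding measurable_cong_sets[OF sets_rho refl] by simp

lemma snd_measurable[measurable]: "snd \<in> borel_measurable \<rho>"
  by (rule measurable_compose[OF snd_measurable_label, of "\<lambda>x. x", unfolded comp_def])
    (simp add: label_space_def)

lemma norm_section_le: "norm (section_at x) \<le> R"
proof -
  have "(norm (section_at x))\<^sup>2 \<le> R\<^sup>2"
    using k_bound[of x] by (simp add: power2_norm_eq_inner inner_section)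
  then show ?thesis
    using R_pos by (simp add: power2_le_iff_abs_le)
qed

lemma eval_at_le: "\<bar>eval_at g x\<bar> \<le> R * norm g"
  using Cauchy_Schwarz_ineq2[of g "section_at x"] mult_left_mono[OF norm_section_le[of x], of "norm g"]
  by (simp add: eval_at_inner mult.commute)

lemma integrable_loss: "integrable \<rho> (\<lambda>z. loss \<phi> (eval_at g (fst z)) (snd z))"
proof (rule integrable_const_bound)
  show "AE z in \<rho>. norm (loss \<phi> (eval_at g (fst z)) (snd z)) \<le> \<bar>\<phi> 0\<bar> + M * (R * norm g)"
  proof (rule AE_I2)
    fix z assume "z \<in> space \<rho>"
    have "\<bar>\<phi> (snd z * eval_at g (fst z))\<bar> \<le> \<bar>\<phi> 0\<bar> + M * \<bar>snd z * eval_at g (fst z)\<bar>"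
      by (rule phi_growth)
    also have "\<bar>snd z * eval_at g (fst z)\<bar> = \<bar>eval_at g (fst z)\<bar>"
      using space_rho[OF \<open>z \<in> space \<rho>\<close>] by (auto simp: abs_mult)
    also have "\<bar>\<phi> 0\<bar> + M * \<dots> \<le> \<bar>\<phi> 0\<bar> + M * (R * norm g)"
      using M_pos eval_at_le by (intro add_left_mono mult_left_mono) auto
    finally show "norm (loss \<phi> (eval_at g (fst z)) (snd z)) \<le> \<bar>\<phi> 0\<bar> + M * (R * norm g)"
      by (simp add: loss_def)
  qed
  show "(\<lambda>z. loss \<phi> (eval_at g (fst z)) (snd z)) \<in> borel_measurable \<rho>"
    unfolding loss_def by measurable
qed

lemma norm_sgrad_le:
  assumes "z \<in> space \<rho>"
  shows "norm (sgrad g z) \<le> M * R"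
  using dloss_bound[OF space_rho[OF assms]] norm_section_le M_pos
  by (auto simp: stoch_grad_def intro!: mult_mono)

lemma inner_sgrad: "inner h (sgrad g z) = snd z * deriv \<phi> (snd z * eval_at g (fst z)) * eval_at h (fst z)"
  by (simp add: stoch_grad_def dloss_eq eval_at_inner)

lemma inner_sgrad_le:
  assumes "z \<in> space \<rho>"
  shows "\<bar>inner h (sgrad g z)\<bar> \<le> norm h * (M * R)"
  by (rule order_trans[OF Cauchy_Schwarz_ineq2]) (intro mult_left_mono norm_sgrad_le assms, simp)

lemma integrable_inner_sgrad: "integrable \<rho> (\<lambda>z. inner h (sgrad g z))"
proof (rule integrable_const_bound)
  show "AE z in \<rho>. norm (inner h (sgrad g z)) \<le> norm h * (M * R)"
    using inner_sgrad_le by (intro AE_I2) simp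
  show "(\<lambda>z. inner h (sgrad g z)) \<in> borel_measurable \<rho>"
    unfolding inner_sgrad by measurable
qed

section \<open>The gradient of the risk and its first-order inequalities\<close>

text \<open>The tangent inequality of \<open>\<phi>\<close>, integrated: the mean stochastic
  gradient acts as a subgradient of the risk. Pairing with \<open>h\<close> keeps the integral
  scalar.\<close>

lemma risk_add_ge: "(\<integral>z. inner h (sgrad g z) \<partial>\<rho>) \<le> rsk (g + h) - rsk g"
proof -
  have "(\<integral>z. inner h (sgrad g z) \<partial>\<rho>)
      \<le> (\<integral>z. loss \<phi> (eval_at (g + h) (fst z)) (snd z) - loss \<phi> (eval_at g (fst z)) (snd z) \<partial>\<rho>)"
  proof (rule integral_mono)
    fix z
    show "inner h (sgrad g z) \<le> loss \<phi> (eval_at (g + h) (fst z)) (snd z) - loss \<phi> (eval_at g (fst z)) (snd z)"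
      using phi_tangent[of "snd z * eval_at g (fst z)" "snd z * eval_at (g + h) (fst z)"]
      by (simp add: inner_sgrad loss_def eval_at_inner inner_add_left algebra_simps)
  qed (intro integrable_inner_sgrad Bochner_Integration.integrable_diff integrable_loss)+
  then show ?thesis
    using integrable_loss by (simp add: risk_def)
qed

text \<open>
  The lower bound above and the smoothness upper bound are both tight to first order along every line,
  which identifies the gradient without differentiating under the integral sign.
\<close>

lemma inner_grad: "inner h (grad g) = (\<integral>z. inner h (sgrad g z) \<partial>\<rho>)"
proof -
  define c where "c = (\<integral>z. inner h (sgrad g z) \<partial>\<rho>) - inner h (grad g)"
  define K where "K = L / 2 * (norm h)\<^sup>2"
  have K: "0 \<le> K" using L_pos by (simp add: K_def)
  \<comment> \<open>This holds for both signs of \<open>t\<close>; a linear function below a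
    quadratic one near \<open>0\<close> on both sides must vanish.\<close>
  have le: "t * c \<le> K * t\<^sup>2" for t
  proof -
    have "t * (\<integral>z. inner h (sgrad g z) \<partial>\<rho>) \<le> rsk (g + t *\<^sub>R h) - rsk g"
      using risk_add_ge[of "t *\<^sub>R h" g] by simp
    moreover have "rsk (g + t *\<^sub>R h) - rsk g - t * inner h (grad g) \<le> L / 2 * (t\<^sup>2 * (norm h)\<^sup>2)"
      using abs_le_D1[OF smooth[of g "t *\<^sub>R h"]] by (simp add: power_mult_distrib inner_commute)
    ultimately show ?thesis
      by (simp add: c_def K_def algebra_simps)
  qed
  \<comment> \<open>At \<open>t = s\<close> the inequality reads
    \<open>(K + 1) * s\<^sup>2 \<le> K * s\<^sup>2\<close>. The added \<open>1\<close> keeps the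
    denominator positive when \<open>K = 0\<close>.\<close>
  define s where "s = c / (K + 1)"
  have c: "c = s * (K + 1)" using K by (simp add: s_def)
  have "s\<^sup>2 \<le> 0"
    using le[of s] unfolding c by (simp add: algebra_simps power2_eq_square)
  then show ?thesis
    using c by (simp add: c_def)
qed

text \<open>The weak identity is tested against the gradient itself, and one factor of its norm
  cancels.\<close>

lemma norm_grad_le: "norm (grad g) \<le> M * R"
proof -
  have "(norm (grad g))\<^sup>2 = (\<integral>z. inner (grad g) (sgrad g z) \<partial>\<rho>)"
    by (simp only: power2_norm_eq_inner inner_grad)
  also have "\<dots> \<le> norm (grad g) * (M * R)"
    by (rule integral_le_const[OF integrable_inner_sgrad AE_I2[OF abs_le_D1[OF inner_sgrad_le]]])
  finally show ?thesis
    using M_pos R_pos by (cases "grad g = 0") (simp_all add: power2_eq_square)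
qed

lemma risk_tangent: "inner (grad g) (h - g) \<le> rsk h - rsk g"
  using risk_add_ge[of "h - g" g] unfolding inner_commute[of "grad g"] inner_grad by simp

lemma risk_lipschitz: "\<bar>rsk g - rsk h\<bar> \<le> M * R * norm (g - h)"
proof -
  have le: "\<bar>inner (grad f) d\<bar> \<le> M * R * norm d" for f d
    by (rule order_trans[OF Cauchy_Schwarz_ineq2 mult_right_mono[OF norm_grad_le norm_ge_zero]])
  show ?thesis
    using risk_tangent[of g h] risk_tangent[of h g] le[of g "h - g"] le[of h "g - h"]
    unfolding norm_minus_commute[of h g] abs_le_iff by linarith
qed

text \<open>The point \<open>h'\<close> is reached from \<open>h\<close> by a step of length
  \<open>1 / L\<close> against the gradient difference. Smoothness at \<open>h\<close> bounds its
  risk above, the tangent at \<open>g\<close> bounds it below, and the comparison leaves the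
  quadratic gain.\<close>

lemma risk_tangent_strong:
  "rsk g + inner (grad g) (h - g) + (norm (grad h - grad g))\<^sup>2 / (2 * L) \<le> rsk h"
proof -
  define D where "D = grad h - grad g"
  define h' where "h' = h - (1 / L) *\<^sub>R D"
  have "rsk h' - rsk h - inner (grad h) (h' - h) \<le> L / 2 * (norm (h' - h))\<^sup>2"
    using abs_le_D1[OF smooth[of h "h' - h"]] by simp
  moreover have "L / 2 * (norm (h' - h))\<^sup>2 = (norm D)\<^sup>2 / (2 * L)"
  proof -
    have "norm (h' - h) = norm D / L"
      using L_pos by (simp add: h'_def)
    then show ?thesis
      using L_pos by (simp add: power_divide power2_eq_square)
  qed
  moreover have "inner (grad g) (h' - g) \<le> rsk h' - rsk g"
    by (rule risk_tangent)
  moreover have "inner (grad g) (h' - g) - inner (grad h) (h' - h) = inner (grad g) (h - g) + (norm D)\<^sup>2 / L"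
    by (simp add: h'_def D_def power2_norm_eq_inner inner_diff_left inner_diff_right inner_commute
        diff_divide_distrib add_divide_distrib)
  ultimately show ?thesis
    unfolding D_def[symmetric] by (simp add: field_simps)
qed

text \<open>Adding the strengthened tangent inequality to the one with \<open>g\<close> and
  \<open>h\<close> exchanged cancels the risks.\<close>

lemma grad_cocoercive: "(norm (grad g - grad h))\<^sup>2 \<le> L * inner (grad g - grad h) (g - h)"
proof -
  have "(norm (grad g - grad h))\<^sup>2 / (2 * L) + (norm (grad g - grad h))\<^sup>2 / (2 * L)
      \<le> inner (grad g - grad h) (g - h)"
    using risk_tangent_strong[of g h] risk_tangent_strong[of h g]
    by (simp add: inner_diff_left inner_diff_right norm_minus_commute)
  then show ?thesis
    using L_pos by (simp add: field_simps)
qed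

text \<open>After expanding the square, cocoercivity bounds the last term by
  \<open>\<eta>\<^sup>2 * L\<close> times \<open>inner D e\<close>, and
  \<open>\<eta> * L \<le> 2 * (1 - \<eta> * lam)\<close> lets the cross term absorb it.\<close>

lemma gradient_step_contraction:
  assumes "0 \<le> \<eta>" "0 < lam" "\<eta> * (L + lam) \<le> 1" "\<eta> * lam \<le> 1 / 2"
  shows "norm ((1 - \<eta> * lam) *\<^sub>R (g - h) - \<eta> *\<^sub>R (grad g - grad h)) \<le> (1 - \<eta> * lam) * norm (g - h)"
proof -
  define e where "e = g - h"
  define D where "D = grad g - grad h"
  define a where "a = 1 - \<eta> * lam"
  have a: "0 \<le> a" using assms by (simp add: a_def)
  have c: "(norm D)\<^sup>2 \<le> L * inner D e"
    unfolding D_def e_def by (rule grad_cocoercive)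
  then have ip: "0 \<le> inner D e"
    using order_trans[OF zero_le_power2 c] L_pos by (simp add: zero_le_mult_iff)
  have "(norm (a *\<^sub>R e - \<eta> *\<^sub>R D))\<^sup>2 = a\<^sup>2 * (norm e)\<^sup>2 - 2 * (\<eta> * a * inner D e) + \<eta>\<^sup>2 * (norm D)\<^sup>2"
    unfolding power2_norm_eq_inner by (simp add: inner_diff inner_commute algebra_simps power2_eq_square)
  also have "\<eta>\<^sup>2 * (norm D)\<^sup>2 \<le> \<eta>\<^sup>2 * (L * inner D e)"
    using c by (intro mult_left_mono) auto
  also have "\<eta>\<^sup>2 * (L * inner D e) = \<eta> * (\<eta> * L) * inner D e"
    by (simp add: power2_eq_square)
  also have "\<dots> \<le> \<eta> * (2 * a) * inner D e"
    using assms ip by (intro mult_right_mono mult_left_mono) (auto simp: a_def algebra_simps)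
  finally have "(norm (a *\<^sub>R e - \<eta> *\<^sub>R D))\<^sup>2 \<le> (a * norm e)\<^sup>2"
    by (simp add: power_mult_distrib)
  then show ?thesis
    using a unfolding a_def[symmetric] e_def[symmetric] D_def[symmetric]
    by (simp add: power2_le_iff_abs_le)
qed

section \<open>Regularised minimisers and the regularisation path\<close>

text \<open>A gradient step on the regularised risk contracts a complete space; its Banach fixed
  point is stationary.\<close>

lemma regularized_stationary_exists:
  assumes "0 < lam"
  shows "\<exists>g. grad g + lam *\<^sub>R g = 0"
proof -
  define \<eta> where "\<eta> = 1 / (L + 2 * lam)"
  have eta: "0 < \<eta>" "\<eta> * (L + lam) \<le> 1" "\<eta> * lam \<le> 1 / 2"
    using assms L_pos by (auto simp: \<eta>_def field_simps)
  define f where "f g = g - \<eta> *\<^sub>R (grad g + lam *\<^sub>R g)" for g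
  have "f g - f h = (1 - \<eta> * lam) *\<^sub>R (g - h) - \<eta> *\<^sub>R (grad g - grad h)" for g h
    by (simp add: f_def algebra_simps)
  then have "\<forall>x y. dist (f x) (f y) \<le> (1 - \<eta> * lam) * dist x y"
    using gradient_step_contraction[of \<eta> lam] eta assms by (simp add: dist_norm)
  then obtain g where "f g = g"
    using banach_fix_type[of "1 - \<eta> * lam" f] eta assms by auto
  then show ?thesis
    using eta by (auto simp: f_def)
qed

text \<open>The tangent inequality and polarisation of \<open>inner g (h - g)\<close> give quadratic
  growth. For positive \<open>lam\<close>, a stationary point is therefore a minimiser, and excess
  regularised risk controls the distance to it.\<close>

lemma regularized_stationary_le:
  assumes "grad g + lam *\<^sub>R g = 0"
  shows "reg_risk \<phi> \<rho> eval_at lam g + lam / 2 * (norm (h - g))\<^sup>2 \<le> reg_risk \<phi> \<rho> eval_at lam h"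
proof -
  have "grad g = - (lam *\<^sub>R g)"
    using assms by (simp add: eq_neg_iff_add_eq_0)
  then have "- (lam * inner g (h - g)) \<le> rsk h - rsk g"
    using risk_tangent[of g h] by simp
  moreover have "inner g (h - g) = ((norm h)\<^sup>2 - (norm g)\<^sup>2 - (norm (h - g))\<^sup>2) / 2"
    unfolding power2_norm_eq_inner by (simp add: inner_diff inner_commute)
  ultimately have "- (lam * (((norm h)\<^sup>2 - (norm g)\<^sup>2 - (norm (h - g))\<^sup>2) / 2)) \<le> rsk h - rsk g"
    by (simp only:)
  then show ?thesis
    by (simp add: reg_risk_def algebra_simps diff_divide_distrib add_divide_distrib)
qed

text \<open>Quadratic growth at each of the two minimisers is tested at the other one. The outcome
  makes the norm decrease in \<open>lam\<close> and reduces the Cauchy property of the path to that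
  of its squared norms.\<close>

lemma regularization_path:
  assumes l: "0 < lam" "lam \<le> lam'" and g: "grad g + lam *\<^sub>R g = 0" and g': "grad g' + lam' *\<^sub>R g' = 0"
  shows "(norm (g - g'))\<^sup>2 \<le> (norm g)\<^sup>2 - (norm g')\<^sup>2"
proof (cases "lam = lam'")
  case True
  have "lam * (norm (g - g'))\<^sup>2 \<le> 0"
    using regularized_stationary_le[OF g, of g'] regularized_stationary_le[OF g', of g]
    unfolding True norm_minus_commute[of g' g] by simp
  then have "g = g'"
    using l by (simp add: mult_le_0_iff)
  then show ?thesis by simp
next
  case False
  define N where "N = (norm (g - g'))\<^sup>2"
  have 1: "lam' / 2 * N \<le> rsk g - rsk g' + lam' / 2 * ((norm g)\<^sup>2 - (norm g')\<^sup>2)"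
    using regularized_stationary_le[OF g', of g] by (simp add: reg_risk_def N_def algebra_simps)
  have 2: "lam / 2 * N \<le> rsk g' - rsk g + lam / 2 * ((norm g')\<^sup>2 - (norm g)\<^sup>2)"
    using regularized_stationary_le[OF g, of g'] by (simp add: reg_risk_def N_def norm_minus_commute algebra_simps)
  have "0 \<le> lam / 2 * N"
    using l by (simp add: N_def)
  \<comment> \<open>Adding 1 and 2 cancels the risks and bounds \<open>(lam' + lam) / 2 * N\<close>.
    Lowering that coefficient to \<open>(lam' - lam) / 2\<close> permits division by the positive
    difference.\<close>
  then have "(lam' - lam) / 2 * N \<le> (lam' - lam) / 2 * ((norm g)\<^sup>2 - (norm g')\<^sup>2)"
    using 1 2 by (simp add: left_diff_distrib right_diff_distrib diff_divide_distrib)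
  then show ?thesis
    using False l by (simp add: N_def)
qed

text \<open>
  The squared norms along the regularisation path are monotone and bounded, so the path is Cauchy.
  No weak compactness is needed.
\<close>

lemma tikhonov_limit:
  assumes min: "\<And>h. rsk gs \<le> rsk h"
  obtains gl where "rsk gl = rsk gs"
    and "\<And>\<epsilon>. 0 < \<epsilon> \<Longrightarrow> \<exists>lam>0. \<exists>g. grad g + lam *\<^sub>R g = 0 \<and> norm (g - gl) < \<epsilon>"
proof -
  define l where "l n = 1 / real (Suc n)" for n
  have l: "0 < l n" for n by (simp add: l_def)
  have l0: "l \<longlonglongrightarrow> 0"
    unfolding l_def using LIMSEQ_inverse_real_of_nat by (simp add: inverse_eq_divide)
  obtain u where u: "\<And>n. grad (u n) + l n *\<^sub>R u n = 0"
    using regularized_stationary_exists[OF l] by metis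
  have reg: "rsk (u n) + l n / 2 * (norm (u n))\<^sup>2 \<le> rsk gs + l n / 2 * (norm gs)\<^sup>2" for n
  proof -
    have "0 \<le> l n / 2 * (norm (gs - u n))\<^sup>2"
      using l[of n] by simp
    then show ?thesis
      using regularized_stationary_le[OF u, of n gs] by (simp add: reg_risk_def)
  qed
  define a where "a n = (norm (u n))\<^sup>2" for n
  have mono: "(norm (u n - u m))\<^sup>2 \<le> a n - a m" if "m \<le> n" for m n
    unfolding a_def using that by (intro regularization_path[OF l _ u u]) (simp add: l_def frac_le)
  have "incseq a"
    using mono by (intro incseq_SucI) (smt (verit) lessI less_imp_le zero_le_power2)
  \<comment> \<open>Minimality of \<open>gs\<close> for the plain risk removes both risks from
    \<open>reg\<close>, leaving the norms.\<close>
  moreover have "a n \<le> (norm gs)\<^sup>2" for n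
  proof -
    have "l n / 2 * a n \<le> l n / 2 * (norm gs)\<^sup>2"
      using reg[of n] min[of "u n"] by (simp add: a_def)
    then show ?thesis
      using l[of n] by simp
  qed
  ultimately obtain c where "a \<longlonglongrightarrow> c"
    using incseq_convergent by metis
  then have "Cauchy a"
    by (rule LIMSEQ_imp_Cauchy)
  have "Cauchy u"
  proof (rule metric_CauchyI)
    fix e :: real assume "0 < e"
    then obtain N where N: "\<And>m n. m \<ge> N \<Longrightarrow> n \<ge> N \<Longrightarrow> dist (a m) (a n) < e\<^sup>2"
      using \<open>Cauchy a\<close> unfolding Cauchy_def by (meson zero_less_power)
    have "dist (u m) (u n) < e" if mn: "m \<ge> N" "n \<ge> N" for m n
    proof -
      have "(norm (u m - u n))\<^sup>2 \<le> \<bar>a m - a n\<bar>"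
        using mono[of m n] mono[of n m] by (cases "m \<le> n") (auto simp: norm_minus_commute)
      also have "\<dots> < e\<^sup>2"
        using N[OF mn] by (simp add: dist_real_def)
      finally show ?thesis
        using \<open>0 < e\<close> by (simp add: dist_norm power_less_imp_less_base)
    qed
    then show "\<exists>N. \<forall>m\<ge>N. \<forall>n\<ge>N. dist (u m) (u n) < e" by blast
  qed
  then obtain gl where gl: "u \<longlonglongrightarrow> gl"
    using Cauchy_convergent_iff convergent_def by blast
  have dist0: "(\<lambda>n. norm (u n - gl)) \<longlonglongrightarrow> 0"
    by (rule tendsto_norm_zero[OF LIM_zero[OF gl]])
  have "rsk gl \<le> rsk gs"
  proof (rule LIMSEQ_le_const)
    have "(\<lambda>n. rsk gs + l n / 2 * (norm gs)\<^sup>2 + M * R * norm (u n - gl))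
        \<longlonglongrightarrow> rsk gs + 0 / 2 * (norm gs)\<^sup>2 + M * R * 0"
      by (rule tendsto_add tendsto_mult tendsto_divide tendsto_const l0 dist0 | simp)+
    then show "(\<lambda>n. rsk gs + l n / 2 * (norm gs)\<^sup>2 + M * R * norm (u n - gl)) \<longlonglongrightarrow> rsk gs"
      by simp
    have "rsk gl \<le> rsk gs + l n / 2 * (norm gs)\<^sup>2 + M * R * norm (u n - gl)" for n
    proof -
      have "0 \<le> l n / 2 * (norm (u n))\<^sup>2" using l[of n] by simp
      then show ?thesis
        using reg[of n] risk_lipschitz[of "u n" gl] by linarith
    qed
    then show "\<exists>N. \<forall>n\<ge>N. rsk gl \<le> rsk gs + l n / 2 * (norm gs)\<^sup>2 + M * R * norm (u n - gl)"
      by blast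
  qed
  moreover have "\<exists>lam>0. \<exists>g. grad g + lam *\<^sub>R g = 0 \<and> norm (g - gl) < \<epsilon>" if eps: "0 < \<epsilon>" for \<epsilon>
  proof -
    obtain n where "norm (u n - gl) < \<epsilon>"
      using order_tendstoD(2)[OF dist0 eps] by (auto simp: eventually_sequentially)
    then show ?thesis
      using l u by blast
  qed
  ultimately show ?thesis
    using that min by (meson order_antisym)
qed

end

section \<open>Deviation of the SGD iterates\<close>

text \<open>Replacing sample \<open>Suc n\<close> leaves the output after \<open>n\<close> steps
  unchanged, which allows integrating over the newest sample first.\<close>

lemma sgd_cong:
  assumes "\<And>i. i \<in> {1..n} \<Longrightarrow> z i = z' i"
  shows "sgd \<phi> eval_at k lam \<eta> g1 z n = sgd \<phi> eval_at k lam \<eta> g1 z' n"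
  using assms by (induction n) simp_all

context smooth_risk
begin

text \<open>
  The type \<open>'h\<close> need not be separable, so measurability is only available for scalar quantities. The kernel
  makes norms of iterates measurable: expanding the square of one step involves only these three.
\<close>

lemma sgd_measurable:
  fixes lam :: real and \<eta> :: "nat \<Rightarrow> real" and g1 h :: 'h
  assumes "finite I" "{1..n} \<subseteq> I"
  defines "G \<equiv> \<lambda>z. sgd \<phi> eval_at k lam \<eta> g1 z n"
  shows "(\<lambda>(z, x). eval_at (G z) x) \<in> borel_measurable (PiM I (\<lambda>_. \<rho>) \<Otimes>\<^sub>M A)"
    and "(\<lambda>z. inner h (G z)) \<in> borel_measurable (PiM I (\<lambda>_. \<rho>))"
    and "(\<lambda>z. inner (G z) (G z)) \<in> borel_measurable (PiM I (\<lambda>_. \<rho>))"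
  unfolding G_def using assms(2)
\<comment> \<open>The index set \<open>I\<close> stays fixed while \<open>n\<close> grows, so the
  product space does not change during the induction.\<close>
proof (induction n arbitrary: h)
  case 0
  { case 1 show ?case by simp }
  { case 2 show ?case by simp }
  { case 3 show ?case by simp }
next
  case (Suc n)
  let ?N = "PiM I (\<lambda>_. \<rho>)"
  let ?g = "\<lambda>z. sgd \<phi> eval_at k lam \<eta> g1 z n"
  define x where "x z = fst (z (Suc n))" for z :: "nat \<Rightarrow> 'x \<times> real"
  define y where "y z = snd (z (Suc n))" for z :: "nat \<Rightarrow> 'x \<times> real"
  define c where "c z = \<eta> (Suc n) * (y z * deriv \<phi> (y z * eval_at (?g z) (x z)))" for z
  define r where "r = 1 - \<eta> (Suc n) * lam"
  have step: "sgd \<phi> eval_at k lam \<eta> g1 z (Suc n) = r *\<^sub>R ?g z - c z *\<^sub>R section_at (x z)" for z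
    by (simp add: stoch_grad_def dloss_eq r_def c_def x_def y_def algebra_simps)
  have sub: "{1..Suc n} \<subseteq> I \<Longrightarrow> {1..n} \<subseteq> I" by auto
  { assume I: "{1..Suc n} \<subseteq> I"
    then have [measurable]: "(\<lambda>z. z (Suc n)) \<in> ?N \<rightarrow>\<^sub>M \<rho>"
      by (intro measurable_component_singleton) auto
    have x[measurable]: "x \<in> ?N \<rightarrow>\<^sub>M A" and y[measurable]: "y \<in> borel_measurable ?N"
      unfolding x_def y_def by measurable
    have eval[measurable]: "(\<lambda>(z, x). eval_at (?g z) x) \<in> borel_measurable (?N \<Otimes>\<^sub>M A)"
      by (rule Suc(1)[OF sub[OF I]])
    \<comment> \<open>The evaluation point depends on \<open>z\<close> as well, hence the joint
      measurability in the first claim.\<close>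
    have eval_x[measurable]: "(\<lambda>z. eval_at (?g z) (x z)) \<in> borel_measurable ?N"
      using measurable_compose[OF _ eval, of "\<lambda>z. (z, x z)"] by simp
    have c[measurable]: "c \<in> borel_measurable ?N"
      unfolding c_def by measurable
    note x y eval eval_x c }
  note meas = this
  { case 1
    note [measurable] = meas[OF 1]
    have "(\<lambda>(z, x'). eval_at (sgd \<phi> eval_at k lam \<eta> g1 z (Suc n)) x')
      = (\<lambda>p. r * (case p of (z, x') \<Rightarrow> eval_at (?g z) x') - c (fst p) * k (x (fst p)) (snd p))"
      unfolding step by (auto simp: eval_at_inner inner_diff_left inner_section split: prod.splits)
    then show ?case by simp }
  { case 2
    note [measurable] = meas[OF 2] Suc(2)[OF sub[OF 2]]
    show ?case
      unfolding step inner_diff_right inner_scaleR_right eval_at_inner[symmetric] by measurable }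
  { case 3
    note [measurable] = meas[OF 3] Suc(3)[OF sub[OF 3]]
    have "inner (r *\<^sub>R ?g z - c z *\<^sub>R section_at (x z)) (r *\<^sub>R ?g z - c z *\<^sub>R section_at (x z))
      = r\<^sup>2 * inner (?g z) (?g z) - 2 * r * c z * eval_at (?g z) (x z) + (c z)\<^sup>2 * k (x z) (x z)" for z
      by (simp add: inner_diff eval_at_inner inner_section inner_commute algebra_simps power2_eq_square)
    then show ?case
      unfolding step by simp }
qed

lemma norm_sgd_measurable:
  assumes "finite I" "{1..n} \<subseteq> I"
  shows "(\<lambda>z. norm (sgd \<phi> eval_at k lam \<eta> g1 z n - h)) \<in> borel_measurable (PiM I (\<lambda>_. \<rho>))"
proof -
  note [measurable] = sgd_measurable[OF assms]
  have "norm (g - h) = sqrt (inner g g - 2 * inner h g + inner h h)" for g :: 'h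
    by (simp add: norm_eq_sqrt_inner inner_diff inner_commute)
  then show ?thesis by simp
qed

section \<open>Exponential moments and tails of the deviation\<close>

text \<open>Step sizes decrease, so the restriction on the first one covers all; its part
  \<open>1 / (2 * lam)\<close> forces \<open>3 \<le> \<gamma>\<close>.\<close>

lemma step_size_bounds:
  assumes lam: "0 < lam" and gam: "0 < \<gamma>"
    and eta1: "step_size lam \<gamma> 1 \<le> min (1 / (L + lam)) (1 / (2 * lam))"
  shows "3 \<le> \<gamma>" "0 < step_size lam \<gamma> (Suc n)" "step_size lam \<gamma> (Suc n) * (L + lam) \<le> 1"
    "step_size lam \<gamma> (Suc n) * lam \<le> 1 / 2"
proof -
  have mono: "step_size lam \<gamma> (Suc n) \<le> step_size lam \<gamma> 1"
    unfolding step_size_def using lam gam by (intro divide_left_mono mult_left_mono mult_pos_pos) auto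
  have "2 / (lam * (\<gamma> + 1)) \<le> 1 / (2 * lam)"
    using eta1 by (simp add: step_size_def)
  then have "2 \<le> 1 / (2 * lam) * (lam * (\<gamma> + 1))"
    using lam gam by (simp only: pos_divide_le_eq mult_pos_pos add_pos_pos zero_less_one)
  then show "3 \<le> \<gamma>"
    using lam by simp
  show "0 < step_size lam \<gamma> (Suc n)"
    using lam gam by (simp add: step_size_def)
  have "step_size lam \<gamma> (Suc n) \<le> 1 / (L + lam)" "step_size lam \<gamma> (Suc n) \<le> 1 / (2 * lam)"
    using mono eta1 by simp_all
  then show "step_size lam \<gamma> (Suc n) * (L + lam) \<le> 1" "step_size lam \<gamma> (Suc n) * lam \<le> 1 / 2"
    using lam L_pos by (simp_all add: pos_le_divide_eq)
qed

text \<open>Up to the scale \<open>\<theta>\<close>, \<open>v\<close> is the deterministic step and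
  \<open>d\<close> the noise. Stationarity makes \<open>gm\<close> a fixed point of the
  deterministic step, so \<open>v\<close> contracts. True and stochastic gradients both have norm at
  most \<open>M * R\<close>, whence the \<open>2\<close> in the noise bound.\<close>

lemma sgd_step_cosh:
  assumes gm: "grad gm + lam *\<^sub>R gm = 0" and lam: "0 < lam"
    and eta: "0 < \<eta>" "\<eta> * (L + lam) \<le> 1" "\<eta> * lam \<le> 1 / 2" and \<theta>: "0 < \<theta>"
  shows "(\<integral>\<^sup>+z. ennreal (cosh (\<theta> * norm (g - \<eta> *\<^sub>R (sgrad g z + lam *\<^sub>R g) - gm))) \<partial>\<rho>)
    \<le> ennreal (cosh (\<theta> * (1 - \<eta> * lam) * norm (g - gm)) * exp ((2 * M * R * \<eta> * \<theta>)\<^sup>2 / 2))"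
proof -
  define v where "v = \<theta> *\<^sub>R ((1 - \<eta> * lam) *\<^sub>R (g - gm) - \<eta> *\<^sub>R (grad g - grad gm))"
  define d where "d z = (\<theta> * \<eta>) *\<^sub>R (grad g - sgrad g z)" for z
  have ggm: "grad gm = - (lam *\<^sub>R gm)"
    using gm by (simp add: eq_neg_iff_add_eq_0)
  have split: "\<theta> *\<^sub>R (g - \<eta> *\<^sub>R (sgrad g z + lam *\<^sub>R g) - gm) = v + d z" for z
    unfolding v_def d_def ggm by (simp add: algebra_simps)
  have norm: "\<theta> * norm (g - \<eta> *\<^sub>R (sgrad g z + lam *\<^sub>R g) - gm) = norm (v + d z)" for z
    using \<theta> by (simp flip: split)
  have "norm (d z) \<le> 2 * M * R * \<eta> * \<theta>" if "z \<in> space \<rho>" for z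
  proof -
    have "norm (grad g - sgrad g z) \<le> 2 * (M * R)"
      using norm_triangle_ineq4[of "grad g" "sgrad g z"] norm_grad_le[of g] norm_sgrad_le[OF that, of g]
      by linarith
    then have "(\<theta> * \<eta>) * norm (grad g - sgrad g z) \<le> (\<theta> * \<eta>) * (2 * (M * R))"
      using eta \<theta> by (intro mult_left_mono) auto
    then show ?thesis
      using eta \<theta> by (simp add: d_def abs_mult mult_ac)
  qed
  moreover have "integrable \<rho> (\<lambda>z. inner v (d z))"
    unfolding d_def inner_scaleR_right inner_diff_right
    by (intro integrable_mult_right Bochner_Integration.integrable_diff integrable_const integrable_inner_sgrad)
  moreover have "(\<integral>z. inner v (d z) \<partial>\<rho>) = 0"
  proof -
    have "(\<integral>z. inner v (grad g) - inner v (sgrad g z) \<partial>\<rho>)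
        = (\<integral>z. inner v (grad g) \<partial>\<rho>) - (\<integral>z. inner v (sgrad g z) \<partial>\<rho>)"
      by (intro Bochner_Integration.integral_diff integrable_const integrable_inner_sgrad)
    also have "(\<integral>z. inner v (grad g) \<partial>\<rho>) = inner v (grad g)"
      by (simp only: lebesgue_integral_const prob_space real_scaleR_def mult_1)
    finally show ?thesis
      unfolding d_def inner_scaleR_right inner_diff_right by (simp flip: inner_grad)
  qed
  moreover have "0 < 2 * M * R * \<eta> * \<theta>"
    using eta \<theta> M_pos R_pos by simp
  ultimately have "(\<integral>\<^sup>+z. ennreal (cosh (norm (v + d z))) \<partial>\<rho>)
      \<le> ennreal (cosh (norm v) * exp ((2 * M * R * \<eta> * \<theta>)\<^sup>2 / 2))"
    by (intro nn_integral_cosh_norm_le) auto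
  also have "norm v \<le> \<theta> * ((1 - \<eta> * lam) * norm (g - gm))"
    unfolding v_def norm_scaleR using eta lam \<theta> gradient_step_contraction[of \<eta> lam g gm] by simp
  then have "cosh (norm v) \<le> cosh (\<theta> * (1 - \<eta> * lam) * norm (g - gm))"
    by (subst cosh_real_nonneg_le_iff) (auto simp: mult.assoc intro: order_trans[OF norm_ge_zero])
  then have "ennreal (cosh (norm v) * exp ((2 * M * R * \<eta> * \<theta>)\<^sup>2 / 2))
      \<le> ennreal (cosh (\<theta> * (1 - \<eta> * lam) * norm (g - gm)) * exp ((2 * M * R * \<eta> * \<theta>)\<^sup>2 / 2))"
    by (intro ennreal_leI mult_right_mono) auto
  finally show ?thesis
    unfolding norm .
qed

text \<open>The induction generalises \<open>\<theta>\<close>: integrating out the newest sample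
  leaves the moment of the previous iterate at the smaller parameter \<open>\<theta> * r\<close>.
  The two quotients by \<open>\<gamma> + real n\<close> are envelopes for the recursions of the
  initial error and of the accumulated noise.\<close>

lemma sgd_cosh_moment:
  assumes gm: "grad gm + lam *\<^sub>R gm = 0" and lam: "0 < lam" and gam: "0 < \<gamma>"
    and eta1: "step_size lam \<gamma> 1 \<le> min (1 / (L + lam)) (1 / (2 * lam))" and "0 < \<theta>"
  defines "K \<equiv> 8 * (M * R / lam)\<^sup>2"
  shows "(\<integral>\<^sup>+z. ennreal (cosh (\<theta> * norm (sgd \<phi> eval_at k lam (step_size lam \<gamma>) g1 z n - gm))) \<partial>PiM {1..n} (\<lambda>_. \<rho>))
    \<le> ennreal (cosh (\<theta> * (\<gamma> / (\<gamma> + real n)) * norm (g1 - gm)) * exp (\<theta>\<^sup>2 * (K / (\<gamma> + real n))))"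
  using \<open>0 < \<theta>\<close>
proof (induction n arbitrary: \<theta>)
  case 0
  interpret P: prob_space "PiM {} (\<lambda>_::nat. \<rho>)"
    by (intro prob_space_PiM) simp
  have "0 \<le> \<theta>\<^sup>2 * (K / \<gamma>)"
    using gam by (simp add: K_def)
  then have "cosh (\<theta> * norm (g1 - gm)) * 1 \<le> cosh (\<theta> * norm (g1 - gm)) * exp (\<theta>\<^sup>2 * (K / \<gamma>))"
    by (intro mult_left_mono) auto
  then show ?case
    using gam P.emeasure_space_1 by (simp add: ennreal_leI)
next
  case (Suc n)
  interpret product_sigma_finite "\<lambda>_::nat. \<rho>"
    by standard
  let ?G = "sgd \<phi> eval_at k lam (step_size lam \<gamma>) g1"
  define \<eta> where "\<eta> = step_size lam \<gamma> (Suc n)"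
  define a where "a = \<gamma> + real (Suc n)"
  define r where "r = 1 - \<eta> * lam"
  define C where "C = exp ((2 * M * R * \<eta> * \<theta>)\<^sup>2 / 2)"
  note steps = step_size_bounds[OF lam gam eta1]
  have eta: "0 < \<eta>" "\<eta> * (L + lam) \<le> 1" "\<eta> * lam \<le> 1 / 2"
    unfolding \<eta>_def by (rule steps)+
  have a: "a > 3"
    using steps(1) by (simp add: a_def)
  have an: "\<gamma> + real n = a - 1"
    by (simp add: a_def)
  have eta_eq: "\<eta> = 2 / (lam * a)"
    by (simp add: \<eta>_def step_size_def a_def)
  have r_eq: "r = 1 - 2 / a"
    using lam by (simp add: r_def eta_eq)
  have r: "0 < r"
    using a by (simp add: r_eq)
  have meas: "(\<lambda>z. norm (?G z m - gm)) \<in> borel_measurable (PiM {1..m} (\<lambda>_. \<rho>))" for m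
    by (rule norm_sgd_measurable) auto
  have C: "0 \<le> C"
    by (simp add: C_def)
  have ins: "{1..Suc n} = insert (Suc n) {1..n}"
    by auto
  \<comment> \<open>Fubini on the product space makes the newest sample the inner integral.\<close>
  have "(\<integral>\<^sup>+z. ennreal (cosh (\<theta> * norm (?G z (Suc n) - gm))) \<partial>PiM {1..Suc n} (\<lambda>_. \<rho>))
    = (\<integral>\<^sup>+z. \<integral>\<^sup>+y. ennreal (cosh (\<theta> * norm (?G (z(Suc n := y)) (Suc n) - gm))) \<partial>\<rho> \<partial>PiM {1..n} (\<lambda>_. \<rho>))"
    unfolding ins
  proof (rule product_nn_integral_insert)
    note [measurable] = meas[of "Suc n", unfolded ins]
    show "(\<lambda>z. ennreal (cosh (\<theta> * norm (?G z (Suc n) - gm)))) \<in> borel_measurable (PiM (insert (Suc n) {1..n}) (\<lambda>_. \<rho>))"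
      unfolding cosh_def by measurable
  qed auto
  also have "\<dots> \<le> (\<integral>\<^sup>+z. ennreal (cosh (\<theta> * r * norm (?G z n - gm))) * ennreal C \<partial>PiM {1..n} (\<lambda>_. \<rho>))"
  proof (rule nn_integral_mono)
    fix z :: "nat \<Rightarrow> 'x \<times> real"
    have "?G (z(Suc n := y)) n = ?G z n" for y
      by (rule sgd_cong) auto
    then show "(\<integral>\<^sup>+y. ennreal (cosh (\<theta> * norm (?G (z(Suc n := y)) (Suc n) - gm))) \<partial>\<rho>)
        \<le> ennreal (cosh (\<theta> * r * norm (?G z n - gm))) * ennreal C"
      using sgd_step_cosh[OF gm lam eta Suc.prems, of "?G z n"] C
      by (simp add: \<eta>_def[symmetric] r_def[symmetric] C_def[symmetric] ennreal_mult'')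
  qed
  also have "\<dots> = (\<integral>\<^sup>+z. ennreal (cosh (\<theta> * r * norm (?G z n - gm))) \<partial>PiM {1..n} (\<lambda>_. \<rho>)) * ennreal C"
  proof (rule nn_integral_multc)
    note [measurable] = meas[of n]
    show "(\<lambda>z. ennreal (cosh (\<theta> * r * norm (?G z n - gm)))) \<in> borel_measurable (PiM {1..n} (\<lambda>_. \<rho>))"
      unfolding cosh_def by measurable
  qed
  also have "\<dots> \<le> ennreal (cosh (\<theta> * r * (\<gamma> / (\<gamma> + real n)) * norm (g1 - gm))
      * exp ((\<theta> * r)\<^sup>2 * (K / (\<gamma> + real n)))) * ennreal C"
    using Suc.prems r by (intro mult_right_mono Suc.IH) auto
  also have "\<dots> = ennreal (cosh (\<theta> * r * (\<gamma> / (\<gamma> + real n)) * norm (g1 - gm))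
      * exp ((\<theta> * r)\<^sup>2 * (K / (\<gamma> + real n)) + (2 * M * R * \<eta> * \<theta>)\<^sup>2 / 2))"
    by (simp add: C_def exp_add ennreal_mult mult.assoc)
  also have "\<dots> \<le> ennreal (cosh (\<theta> * (\<gamma> / (\<gamma> + real (Suc n))) * norm (g1 - gm))
      * exp (\<theta>\<^sup>2 * (K / (\<gamma> + real (Suc n)))))"
  proof (intro ennreal_leI mult_mono)
    \<comment> \<open>Here \<open>r * a\<close> equals \<open>a - 2\<close>, while the envelope
      allows \<open>a - 1\<close>.\<close>
    have "r * (\<gamma> / (a - 1)) \<le> \<gamma> / a"
    proof -
      have "r * a \<le> a - 1"
        using a by (simp add: r_eq field_simps)
      then have "\<gamma> * (r * a) \<le> \<gamma> * (a - 1)"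
        using gam by (intro mult_left_mono) auto
      then show ?thesis
        using a by (simp add: field_simps)
    qed
    then have "\<theta> * (r * (\<gamma> / (a - 1))) * norm (g1 - gm) \<le> \<theta> * (\<gamma> / a) * norm (g1 - gm)"
      using Suc.prems by (intro mult_right_mono mult_left_mono) auto
    moreover have "0 \<le> \<theta> * (r * (\<gamma> / (a - 1))) * norm (g1 - gm)"
      using Suc.prems r gam a by (intro mult_nonneg_nonneg divide_nonneg_nonneg) auto
    ultimately show "cosh (\<theta> * r * (\<gamma> / (\<gamma> + real n)) * norm (g1 - gm))
        \<le> cosh (\<theta> * (\<gamma> / (\<gamma> + real (Suc n))) * norm (g1 - gm))"
      unfolding an a_def[symmetric] mult.assoc[of \<theta> r] by (subst cosh_real_nonneg_le_iff) auto
    \<comment> \<open>The noise recursion; after clearing denominators it says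
      \<open>3 \<le> 2 * a\<close>.\<close>
    have "r\<^sup>2 / (a - 1) + 1 / a\<^sup>2 \<le> 1 / a"
    proof -
      have "r = (a - 2) / a"
        using a by (simp add: r_eq diff_divide_distrib)
      then have "r\<^sup>2 / (a - 1) + 1 / a\<^sup>2 = ((a - 2)\<^sup>2 + (a - 1)) / (a\<^sup>2 * (a - 1))"
        using a by (simp add: power_divide add_divide_distrib)
      also have "\<dots> \<le> (a * (a - 1)) / (a\<^sup>2 * (a - 1))"
        using a by (intro divide_right_mono) (auto simp: power2_eq_square algebra_simps)
      also have "\<dots> = 1 / a"
        using a by (simp add: power2_eq_square)
      finally show ?thesis .
    qed
    then have "\<theta>\<^sup>2 * (K * (r\<^sup>2 / (a - 1) + 1 / a\<^sup>2)) \<le> \<theta>\<^sup>2 * (K * (1 / a))"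
      by (intro mult_left_mono) (auto simp: K_def)
    \<comment> \<open>The constant \<open>8\<close> in \<open>K\<close> comes from inserting
      \<open>\<eta> = 2 / (lam * a)\<close>.\<close>
    moreover have "(2 * M * R * \<eta> * \<theta>)\<^sup>2 / 2 = \<theta>\<^sup>2 * (K * (1 / a\<^sup>2))"
      by (simp add: eta_eq K_def power_mult_distrib power_divide mult_ac)
    ultimately show "exp ((\<theta> * r)\<^sup>2 * (K / (\<gamma> + real n)) + (2 * M * R * \<eta> * \<theta>)\<^sup>2 / 2)
        \<le> exp (\<theta>\<^sup>2 * (K / (\<gamma> + real (Suc n))))"
      unfolding an a_def[symmetric] by (simp add: power_mult_distrib algebra_simps)
  qed auto
  finally show ?case .
qed

lemma sgd_deviation:
  assumes gm: "grad gm + lam *\<^sub>R gm = 0" and lam: "0 < lam" and gam: "0 < \<gamma>"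
    and eta1: "step_size lam \<gamma> 1 \<le> min (1 / (L + lam)) (1 / (2 * lam))"
    and \<epsilon>: "0 < \<epsilon>" and start: "\<gamma> / (\<gamma> + real n) * norm (g1 - gm) \<le> \<epsilon> / 2"
    and D: "\<And>z. D z \<le> of_bool (\<epsilon> \<le> norm (sgd \<phi> eval_at k lam (step_size lam \<gamma>) g1 z n - gm))"
  shows "(\<integral>z. D z \<partial>PiM {1..n} (\<lambda>_. \<rho>)) \<le> 2 * exp (- (\<epsilon>\<^sup>2 * lam\<^sup>2 * (\<gamma> + real n) / (128 * M\<^sup>2 * R\<^sup>2)))"
\<comment> \<open>If \<open>D\<close> is not integrable, its integral is \<open>0\<close> by
  convention and the bound is trivial.\<close>
proof (cases "integrable (PiM {1..n} (\<lambda>_. \<rho>)) D")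
  case True
  let ?N = "PiM {1..n} (\<lambda>_. \<rho>)"
  define e where "e z = norm (sgd \<phi> eval_at k lam (step_size lam \<gamma>) g1 z n - gm)" for z
  define a where "a = \<gamma> + real n"
  define K where "K = 8 * (M * R / lam)\<^sup>2 / a"
  have a: "0 < a" using gam by (simp add: a_def)
  have K: "0 < K" using M_pos R_pos lam a by (simp add: K_def)
  \<comment> \<open>The initial error uses up half of \<open>\<theta> * \<epsilon>\<close>, so the
    exponent is \<open>\<theta>\<^sup>2 * K - \<theta> * \<epsilon> / 2\<close>. This is its
    minimiser, with value \<open>- (\<epsilon>\<^sup>2 / (16 * K))\<close>.\<close>
  define \<theta> where "\<theta> = \<epsilon> / (4 * K)"
  have \<theta>: "0 < \<theta>" using \<epsilon> K by (simp add: \<theta>_def)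
  define p where "p = \<gamma> / a * norm (g1 - gm)"
  have p: "0 \<le> p" "p \<le> \<epsilon> / 2"
    using gam a start by (auto simp: p_def a_def)
  define B where "B = cosh (\<theta> * p) * exp (\<theta>\<^sup>2 * K)"
  have "e \<in> borel_measurable ?N"
    unfolding e_def by (rule norm_sgd_measurable) auto
  then have meas: "(\<lambda>z. cosh (\<theta> * e z)) \<in> borel_measurable ?N"
    unfolding cosh_def by measurable
  have nn: "(\<integral>\<^sup>+z. ennreal (cosh (\<theta> * e z)) \<partial>?N) \<le> ennreal B"
    using sgd_cosh_moment[OF gm lam gam eta1 \<theta>, of n g1]
    by (simp add: e_def B_def p_def K_def a_def mult.assoc)
  then have int: "integrable ?N (\<lambda>z. cosh (\<theta> * e z))"
    using le_less_trans[OF nn ennreal_less_top] by (intro integrableI_nonneg meas AE_I2 cosh_real_nonneg) simp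
  have "ennreal (\<integral>z. cosh (\<theta> * e z) \<partial>?N) \<le> ennreal B"
    using nn nn_integral_eq_integral[OF int] by simp
  then have "(\<integral>z. cosh (\<theta> * e z) \<partial>?N) \<le> B"
    by (simp add: ennreal_le_iff B_def)
  have "(\<integral>z. D z \<partial>?N) \<le> (\<integral>z. cosh (\<theta> * e z) / cosh (\<theta> * \<epsilon>) \<partial>?N)"
  proof (rule integral_mono[OF True])
    show "integrable ?N (\<lambda>z. cosh (\<theta> * e z) / cosh (\<theta> * \<epsilon>))"
      using int by simp
    fix z
    have "D z \<le> of_bool (\<epsilon> \<le> e z)"
      unfolding e_def by (rule D)
    also have "\<dots> \<le> cosh (\<theta> * e z) / cosh (\<theta> * \<epsilon>)"
    proof (cases "\<epsilon> \<le> e z")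
      case True
      then have "cosh (\<theta> * \<epsilon>) \<le> cosh (\<theta> * e z)"
        using \<theta> \<epsilon> by (subst cosh_real_nonneg_le_iff) auto
      then show ?thesis
        using True by simp
    qed simp
    finally show "D z \<le> cosh (\<theta> * e z) / cosh (\<theta> * \<epsilon>)" .
  qed
  also have "\<dots> \<le> B / cosh (\<theta> * \<epsilon>)"
    using \<open>(\<integral>z. cosh (\<theta> * e z) \<partial>?N) \<le> B\<close> by (simp add: divide_right_mono)
  \<comment> \<open>The prefactor \<open>2\<close> of the final bound comes from estimating
    \<open>cosh\<close> below by half of \<open>exp\<close>.\<close>
  also have "\<dots> \<le> (exp (\<theta> * \<epsilon> / 2) * exp (\<theta>\<^sup>2 * K)) / (exp (\<theta> * \<epsilon>) / 2)"
  proof (rule frac_le)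
    have "cosh (\<theta> * p) \<le> cosh (\<theta> * \<epsilon> / 2)"
      using \<theta> p by (subst cosh_real_nonneg_le_iff) auto
    also have "\<dots> \<le> exp (\<theta> * \<epsilon> / 2)"
      using \<theta> \<epsilon> by (simp add: cosh_def)
    finally show "B \<le> exp (\<theta> * \<epsilon> / 2) * exp (\<theta>\<^sup>2 * K)"
      by (simp add: B_def)
    show "exp (\<theta> * \<epsilon>) / 2 \<le> cosh (\<theta> * \<epsilon>)"
      by (simp add: cosh_def)
  qed auto
  also have "\<dots> = 2 * exp (\<theta> * \<epsilon> / 2 + \<theta>\<^sup>2 * K - \<theta> * \<epsilon>)"
    by (simp only: exp_diff exp_add) simp
  also have "\<theta> * \<epsilon> / 2 + \<theta>\<^sup>2 * K - \<theta> * \<epsilon> = - (\<epsilon>\<^sup>2 / (16 * K))"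
    using K by (simp add: \<theta>_def field_simps power2_eq_square)
  also have "\<epsilon>\<^sup>2 / (16 * K) = \<epsilon>\<^sup>2 * lam\<^sup>2 * (\<gamma> + real n) / (128 * M\<^sup>2 * R\<^sup>2)"
    using lam a by (simp add: K_def a_def power_divide power_mult_distrib)
  finally show ?thesis .
qed (simp add: not_integrable_integral_eq)

end

section \<open>Classification error near the Bayes rule\<close>

locale binary_classification = smooth_risk A k eval_at \<rho> \<phi> M L R
  for A :: "'x measure" and k and eval_at :: "'h::{real_inner,complete_space} \<Rightarrow> 'x \<Rightarrow> real"
    and \<rho> :: "('x \<times> real) measure" and \<phi> M L R +
  fixes \<kappa> :: "'x \<Rightarrow> real measure" and \<delta> :: real
  assumes cond: "conditional_distribution A \<rho> \<kappa>"
    and phi_nonneg: "\<And>u. 0 \<le> \<phi> u"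
    and delta: "\<delta> \<in> {0<..<1/2}"
    and noise: "AE x in marginal A \<rho>. \<bar>measure (\<kappa> x) {1} - 1/2\<bar> > \<delta>"
    and cond_interior: "AE x in marginal A \<rho>. measure (\<kappa> x) {1} \<in> {0<..<1}"
    and link_wd: "link_well_defined \<phi>"
    and link_mono: "mono_on {0<..<1} (link \<phi>)"
    and link_sgn: "\<And>\<mu>. \<mu> \<in> {0<..<1} \<Longrightarrow> sgn (\<mu> - 1/2) = sgn (link \<phi> \<mu>)"
    and bayes: "\<exists>gs. bayes_rule A \<phi> \<rho> (eval_at gs) \<and>
                  (\<forall>f. bayes_rule A \<phi> \<rho> f \<longrightarrow> (AE x in marginal A \<rho>. f x = eval_at gs x))"
begin

section \<open>Conditional label probability and disintegration of the risk\<close>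

definition posterior :: "'x \<Rightarrow> real" where
  "posterior x = measure (\<kappa> x) {1}"

lemma kappa_measurable[measurable]: "\<kappa> \<in> A \<rightarrow>\<^sub>M prob_algebra label_space"
  using cond by (simp add: conditional_distribution_def)

lemma sets_label: "{c} \<in> sets label_space" if "c \<in> {-1, 1}" for c
  using that by (auto simp: label_space_def)

lemma posterior_measurable[measurable]: "posterior \<in> borel_measurable A"
  unfolding posterior_def using measurable_compose[OF kappa_measurable measurable_measure_prob_algebra] sets_label by simp

lemma emeasure_kappa_measurable:
  assumes "c \<in> {-1, 1}"
  shows "(\<lambda>x. emeasure (\<kappa> x) {c}) \<in> borel_measurable A"
  by (rule measurable_compose[OF measurable_prob_algebraD[OF kappa_measurable]
        measurable_emeasure_subprob_algebra[OF sets_label[OF assms]]])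

lemma prob_kappa: "prob_space (\<kappa> x)" and sets_kappa: "sets (\<kappa> x) = sets label_space"
  using measurable_space[OF kappa_measurable, of x] space_A by (simp_all add: space_prob_algebra)

lemma space_kappa: "space (\<kappa> x) = {-1, 1}"
  using sets_eq_imp_space_eq[OF sets_kappa] by (simp add: label_space_def)

lemma emeasure_kappa:
  "emeasure (\<kappa> x) {1} = ennreal (posterior x)" "emeasure (\<kappa> x) {-1} = ennreal (1 - posterior x)"
  and posterior_bounds: "0 \<le> posterior x" "posterior x \<le> 1"
proof -
  interpret K: prob_space "\<kappa> x" by (rule prob_kappa)
  have "{-1, 1} - {1} = {-1::real}" by auto
  then have "K.prob {-1} = 1 - K.prob {1}"
    using K.prob_compl[of "{1}"] by (simp add: space_kappa sets_kappa sets_label)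
  then show "emeasure (\<kappa> x) {1} = ennreal (posterior x)" "emeasure (\<kappa> x) {-1} = ennreal (1 - posterior x)"
    by (simp_all add: K.emeasure_eq_measure posterior_def)
  show "0 \<le> posterior x" "posterior x \<le> 1"
    by (simp_all add: posterior_def)
qed

text \<open>The reference classifier thus has the sign of \<open>posterior x - 1 / 2\<close>, which
  is also the sign of the link.\<close>

lemma expectation_kappa: "(\<integral>y. y \<partial>\<kappa> x) = 2 * posterior x - 1"
proof -
  interpret K: prob_space "\<kappa> x" by (rule prob_kappa)
  have int: "integrable (\<kappa> x) (indicator {1} :: real \<Rightarrow> real)"
    using sets_label[of 1] by (intro integrable_real_indicator) (auto simp: sets_kappa K.emeasure_eq_measure)
  have "(\<integral>y. y \<partial>\<kappa> x) = (\<integral>y. 2 * indicator {1} y - 1 \<partial>\<kappa> x)"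
    by (intro Bochner_Integration.integral_cong) (auto simp: space_kappa)
  also have "\<dots> = (\<integral>y. 2 * indicator {1} y \<partial>\<kappa> x) - (\<integral>y. 1 \<partial>\<kappa> x)"
    by (rule Bochner_Integration.integral_diff[OF integrable_mult_right[OF int] K.integrable_const])
  also have "\<dots> = 2 * posterior x - 1"
    using K.prob_space by (simp add: posterior_def space_kappa)
  finally show ?thesis .
qed

text \<open>Restricting \<open>\<rho>\<close> to the label \<open>c\<close> and projecting to the
  features gives the marginal with density \<open>emeasure (\<kappa> x) {c}\<close>. The two
  measures agree on sets by definition of \<open>\<kappa>\<close>, hence on integrals.\<close>

lemma nn_integral_label:
  assumes u[measurable]: "u \<in> borel_measurable A" and c: "c \<in> {-1, 1}"
  shows "(\<integral>\<^sup>+z. u (fst z) * indicator {c} (snd z) \<partial>\<rho>) = (\<integral>\<^sup>+x. u x * emeasure (\<kappa> x) {c} \<partial>marginal A \<rho>)"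
proof -
  have [measurable]: "(\<lambda>z. indicator {c} (snd z) :: ennreal) \<in> borel_measurable \<rho>"
    by measurable
  have [measurable]: "(\<lambda>x. emeasure (\<kappa> x) {c}) \<in> borel_measurable A"
    by (rule emeasure_kappa_measurable[OF c])
  have sets_marginal: "sets (marginal A \<rho>) = sets A"
    by (simp add: marginal_def)
  have marg: "f \<in> borel_measurable (marginal A \<rho>)" if "f \<in> borel_measurable A" for f :: "'x \<Rightarrow> ennreal"
    using that by (simp add: measurable_cong_sets[OF sets_marginal refl])
  have eq: "distr (density \<rho> (\<lambda>z. indicator {c} (snd z))) A fst
      = density (marginal A \<rho>) (\<lambda>x. emeasure (\<kappa> x) {c})"
  proof (rule measure_eqI)
    fix B assume "B \<in> sets (distr (density \<rho> (\<lambda>z. indicator {c} (snd z))) A fst)"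
    then have B[measurable]: "B \<in> sets A" by simp
    have sub: "B \<times> {c} \<in> sets \<rho>"
      using sets_label[OF c] by (simp add: sets_rho pair_measureI)
    have "emeasure (distr (density \<rho> (\<lambda>z. indicator {c} (snd z))) A fst) B
        = (\<integral>\<^sup>+z. indicator {c} (snd z) * indicator (fst -` B \<inter> space \<rho>) z \<partial>\<rho>)"
      by (simp add: emeasure_distr emeasure_density)
    also have "\<dots> = (\<integral>\<^sup>+z. indicator (B \<times> {c}) z \<partial>\<rho>)"
      by (intro nn_integral_cong) (auto simp: indicator_def)
    also have "\<dots> = emeasure \<rho> (B \<times> {c})"
      by (rule nn_integral_indicator[OF sub])
    also have "\<dots> = (\<integral>\<^sup>+x\<in>B. emeasure (\<kappa> x) {c} \<partial>marginal A \<rho>)"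
      using cond sets_label[OF c] B by (simp add: conditional_distribution_def)
    also have "\<dots> = emeasure (density (marginal A \<rho>) (\<lambda>x. emeasure (\<kappa> x) {c})) B"
      using B by (simp add: emeasure_density marg sets_marginal)
    finally show "emeasure (distr (density \<rho> (\<lambda>z. indicator {c} (snd z))) A fst) B = \<dots>" .
  qed (simp add: sets_marginal)
  have "(\<integral>\<^sup>+z. u (fst z) * indicator {c} (snd z) \<partial>\<rho>)
      = (\<integral>\<^sup>+x. u x \<partial>distr (density \<rho> (\<lambda>z. indicator {c} (snd z))) A fst)"
    by (simp add: nn_integral_distr nn_integral_density mult.commute)
  also have "\<dots> = (\<integral>\<^sup>+x. u x * emeasure (\<kappa> x) {c} \<partial>marginal A \<rho>)"
    unfolding eq by (simp add: nn_integral_density marg mult.commute)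
  finally show ?thesis .
qed

text \<open>Splitting by label makes the risk an integral of pointwise risks, which can be minimised
  pointwise. Nonnegative integrals cover functions of infinite risk too.\<close>

lemma nn_integral_loss:
  assumes f[measurable]: "f \<in> borel_measurable A"
  shows "(\<integral>\<^sup>+z. ennreal (loss \<phi> (f (fst z)) (snd z)) \<partial>\<rho>)
    = (\<integral>\<^sup>+x. ennreal (cond_risk \<phi> (posterior x) (f x)) \<partial>marginal A \<rho>)"
proof -
  have kappa: "(\<lambda>x. u x * emeasure (\<kappa> x) {c}) \<in> borel_measurable (marginal A \<rho>)"
    if "u \<in> borel_measurable A" "c \<in> {-1, 1}" for u c
    using that(1) emeasure_kappa_measurable[OF that(2)] by (simp add: marginal_def)
  have "(\<integral>\<^sup>+z. ennreal (loss \<phi> (f (fst z)) (snd z)) \<partial>\<rho>)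
      = (\<integral>\<^sup>+z. ennreal (\<phi> (f (fst z))) * indicator {1} (snd z) + ennreal (\<phi> (- f (fst z))) * indicator {-1} (snd z) \<partial>\<rho>)"
    using space_rho by (intro nn_integral_cong) (force simp: loss_def indicator_def)
  also have "\<dots> = (\<integral>\<^sup>+z. ennreal (\<phi> (f (fst z))) * indicator {1} (snd z) \<partial>\<rho>)
      + (\<integral>\<^sup>+z. ennreal (\<phi> (- f (fst z))) * indicator {-1} (snd z) \<partial>\<rho>)"
    by (rule nn_integral_add) measurable
  also have "\<dots> = (\<integral>\<^sup>+x. ennreal (\<phi> (f x)) * emeasure (\<kappa> x) {1} \<partial>marginal A \<rho>)
      + (\<integral>\<^sup>+x. ennreal (\<phi> (- f x)) * emeasure (\<kappa> x) {-1} \<partial>marginal A \<rho>)"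
    by (intro arg_cong2[where f = "(+)"] nn_integral_label) auto
  also have "\<dots> = (\<integral>\<^sup>+x. ennreal (\<phi> (f x)) * emeasure (\<kappa> x) {1} + ennreal (\<phi> (- f x)) * emeasure (\<kappa> x) {-1} \<partial>marginal A \<rho>)"
    by (intro nn_integral_add[symmetric] kappa) auto
  also have "\<dots> = (\<integral>\<^sup>+x. ennreal (cond_risk \<phi> (posterior x) (f x)) \<partial>marginal A \<rho>)"
    using phi_nonneg posterior_bounds
    by (intro nn_integral_cong) (simp add: emeasure_kappa cond_risk_def mult.commute flip: ennreal_mult ennreal_plus)
  finally show ?thesis .
qed

section \<open>The link function as Bayes rule\<close>

lemma link_minimizes:
  assumes "m \<in> {0<..<1}"
  shows "cond_risk \<phi> m (link \<phi> m) \<le> cond_risk \<phi> m h"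
proof -
  have "\<exists>h. is_arg_min (cond_risk \<phi> m) (\<lambda>_. True) h"
    using link_wd assms by (auto simp: link_well_defined_def)
  then have "is_arg_min (cond_risk \<phi> m) (\<lambda>_. True) (link \<phi> m)"
    unfolding link_def arg_min_def by (rule someI_ex)
  then show ?thesis
    by (auto simp: is_arg_min_def not_less)
qed

text \<open>The link minimises the pointwise risk almost everywhere. It is monotone, hence
  measurable, only on the open unit interval, so the indicator extends it by zero outside.\<close>

lemma bayes_rule_link: "bayes_rule A \<phi> \<rho> (\<lambda>x. indicator {0<..<1} (posterior x) *\<^sub>R link \<phi> (posterior x))"
proof -
  define f where "f x = indicator {0<..<1} (posterior x) *\<^sub>R link \<phi> (posterior x)" for x
  have "(\<lambda>m. indicator {0<..<1} m *\<^sub>R link \<phi> m) \<in> borel_measurable borel"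
    using borel_measurable_mono_on_fnc[OF link_mono]
    by (subst (asm) borel_measurable_restrict_space_iff) auto
  then have f[measurable]: "f \<in> borel_measurable A"
    unfolding f_def[abs_def] by (rule measurable_compose[OF posterior_measurable])
  have le: "(\<integral>\<^sup>+z. ennreal (loss \<phi> (f (fst z)) (snd z)) \<partial>\<rho>) \<le> (\<integral>\<^sup>+z. ennreal (loss \<phi> (h (fst z)) (snd z)) \<partial>\<rho>)"
    if "h \<in> borel_measurable A" for h
    unfolding nn_integral_loss[OF that] nn_integral_loss[OF f]
  proof (rule nn_integral_mono_AE)
    show "AE x in marginal A \<rho>. ennreal (cond_risk \<phi> (posterior x) (f x)) \<le> ennreal (cond_risk \<phi> (posterior x) (h x))"
      using cond_interior by eventually_elim (auto simp: f_def posterior_def intro!: ennreal_leI link_minimizes)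
  qed
  \<comment> \<open>Comparison with the zero function makes the risk finite, hence the loss
    integrable.\<close>
  have "(\<integral>\<^sup>+z. ennreal (loss \<phi> (f (fst z)) (snd z)) \<partial>\<rho>) \<le> ennreal (\<phi> 0)"
    using le[of "\<lambda>_. 0"] by (simp add: loss_def emeasure_space_1)
  then have int: "integrable \<rho> (\<lambda>z. loss \<phi> (f (fst z)) (snd z))"
    using phi_nonneg unfolding loss_def
    by (intro integrableI_nonneg) (auto intro: le_less_trans)
  have "risk \<phi> \<rho> f \<le> risk \<phi> \<rho> h"
    if h: "h \<in> borel_measurable A" "integrable \<rho> (\<lambda>z. loss \<phi> (h (fst z)) (snd z))" for h
  proof -
    have "0 \<le> risk \<phi> \<rho> h"
      using phi_nonneg by (simp add: risk_def loss_def)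
    moreover have "ennreal (risk \<phi> \<rho> f) \<le> ennreal (risk \<phi> \<rho> h)"
      using le[OF h(1)] nn_integral_eq_integral[OF int] nn_integral_eq_integral[OF h(2)] phi_nonneg
      by (simp add: risk_def loss_def)
    ultimately show ?thesis
      by (simp add: ennreal_le_iff)
  qed
  then show ?thesis
    using f int unfolding f_def[abs_def, symmetric] by (auto simp: bayes_rule_def is_arg_min_def not_less)
qed

text \<open>An RKHS function of minimal risk and the link of the posterior are both Bayes rules, so
  uniqueness identifies each with \<open>gs\<close> almost everywhere.\<close>

lemma risk_minimizer_is_link:
  obtains gs where "\<And>h. rsk gs \<le> rsk h"
    and "\<And>g. rsk g = rsk gs \<Longrightarrow> AE x in marginal A \<rho>. eval_at g x = link \<phi> (posterior x)"
proof -
  obtain gs where gs: "bayes_rule A \<phi> \<rho> (eval_at gs)"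
    and uniq: "\<And>f. bayes_rule A \<phi> \<rho> f \<Longrightarrow> AE x in marginal A \<rho>. f x = eval_at gs x"
    using bayes by blast
  have min: "risk \<phi> \<rho> (eval_at gs) \<le> risk \<phi> \<rho> f"
    if "f \<in> borel_measurable A" "integrable \<rho> (\<lambda>z. loss \<phi> (f (fst z)) (snd z))" for f
    using gs that unfolding bayes_rule_def is_arg_min_def by (meson not_less)
  show ?thesis
  proof (rule that)
    show "rsk gs \<le> rsk h" for h
      by (rule min[OF eval_at_measurable integrable_loss])
    fix g assume g: "rsk g = rsk gs"
    have "bayes_rule A \<phi> \<rho> (eval_at g)"
      unfolding bayes_rule_def is_arg_min_def g using min by (auto simp: integrable_loss not_less)
    from uniq[OF this] uniq[OF bayes_rule_link] cond_interior
    show "AE x in marginal A \<rho>. eval_at g x = link \<phi> (posterior x)"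
      by eventually_elim (simp add: posterior_def)
  qed
qed

lemma margin_pos: "0 < margin \<phi> \<delta>"
proof -
  have "0 < link \<phi> (1 / 2 + \<delta>)" "link \<phi> (1 / 2 - \<delta>) < 0"
    using link_sgn[of "1 / 2 + \<delta>"] link_sgn[of "1 / 2 - \<delta>"] delta
    by (auto simp: sgn_if split: if_splits)
  then show ?thesis
    by (simp add: margin_def)
qed

lemma link_margin:
  assumes "m \<in> {0<..<1}" "\<bar>m - 1 / 2\<bar> > \<delta>"
  shows "margin \<phi> \<delta> \<le> \<bar>link \<phi> m\<bar>"
proof (cases "m > 1 / 2")
  case True
  then have "link \<phi> (1 / 2 + \<delta>) \<le> link \<phi> m"
    using assms delta by (intro mono_onD[OF link_mono]) auto
  then show ?thesis
    by (simp add: margin_def)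
next
  case False
  then have "link \<phi> m \<le> link \<phi> (1 / 2 - \<delta>)"
    using assms delta by (intro mono_onD[OF link_mono]) auto
  moreover have "link \<phi> (1 / 2 - \<delta>) < 0"
    using link_sgn[of "1 / 2 - \<delta>"] delta by (auto simp: sgn_if split: if_splits)
  ultimately show ?thesis
    by (simp add: margin_def)
qed

text \<open>The kernel bound turns norm distance into uniform distance. A perturbation below the
  margin cannot flip the sign of \<open>gl\<close>, and the classification error depends only on
  signs.\<close>

lemma class_error_optimal:
  assumes gl: "AE x in marginal A \<rho>. eval_at gl x = link \<phi> (posterior x)"
    and close: "norm (g - gl) < margin \<phi> \<delta> / R"
  shows "class_error \<rho> (eval_at g) = class_error \<rho> (\<lambda>x. \<integral>y. y \<partial>\<kappa> x)"
proof -
  have "AE x in marginal A \<rho>. sgn (eval_at g x) = sgn (2 * posterior x - 1)"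
    using gl noise cond_interior
  proof eventually_elim
    case (elim x)
    have mu: "posterior x \<in> {0<..<1}" "\<bar>posterior x - 1 / 2\<bar> > \<delta>"
      using elim by (simp_all add: posterior_def)
    have "\<bar>eval_at g x - eval_at gl x\<bar> = \<bar>eval_at (g - gl) x\<bar>"
      by (simp add: eval_at_inner inner_diff_left)
    also have "\<dots> \<le> R * norm (g - gl)"
      by (rule eval_at_le)
    also have "\<dots> < margin \<phi> \<delta>"
      using close R_pos by (simp add: pos_less_divide_eq mult.commute)
    also have "\<dots> \<le> \<bar>eval_at gl x\<bar>"
      using link_margin[OF mu] elim by simp
    finally have "sgn (eval_at g x) = sgn (eval_at gl x)"
      by (auto simp: sgn_if abs_if split: if_splits)
    also have "\<dots> = sgn (posterior x - 1 / 2)"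
      using link_sgn[OF mu(1)] elim by simp
    also have "\<dots> = sgn (2 * posterior x - 1)"
      by (simp add: sgn_if)
    finally show ?case .
  qed
  then have "AE z in \<rho>. sgn (eval_at g (fst z)) = sgn (2 * posterior (fst z) - 1)"
    unfolding marginal_def by (rule AE_distrD[OF fst_measurable])
  then show ?thesis
    unfolding class_error_def expectation_kappa
    by (intro integral_cong_AE) auto
qed

lemma class_error_diff_le_1: "class_error \<rho> (eval_at g) - class_error \<rho> f \<le> 1"
proof -
  have "integrable \<rho> (\<lambda>z. of_bool (sgn (eval_at g (fst z)) \<noteq> snd z) :: real)"
    by (rule integrable_const_bound[where B = 1]) auto
  then have "class_error \<rho> (eval_at g) \<le> 1"
    unfolding class_error_def by (rule integral_le_const) auto
  moreover have "0 \<le> class_error \<rho> f"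
    unfolding class_error_def by (rule Bochner_Integration.integral_nonneg) simp
  ultimately show ?thesis by simp
qed

end

section \<open>Choice of the regularisation parameter and assembly of the tail bound\<close>

theorem theorem1:
  fixes A :: "'x::topological_space measure"
    and \<rho> :: "('x \<times> real) measure"
    and \<kappa> :: "'x \<Rightarrow> real measure"
    and k :: "'x \<Rightarrow> 'x \<Rightarrow> real"
    and eval_at :: "'h::{real_inner,complete_space} \<Rightarrow> 'x \<Rightarrow> real"
    and \<phi> :: "real \<Rightarrow> real"
    and M L R \<delta> :: real
  assumes space_A: "space A = UNIV" and borel_A: "sets borel \<subseteq> sets A"
    and prob: "prob_space \<rho>" and sets_rho: "sets \<rho> = sets (A \<Otimes>\<^sub>M label_space)"
    and cond: "conditional_distribution A \<rho> \<kappa>"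
    and rkhs: "is_rkhs k eval_at"
    and k_meas: "case_prod k \<in> borel_measurable (A \<Otimes>\<^sub>M A)"
    and phi_nonneg: "\<And>u. 0 \<le> \<phi> u"
    and phi_convex: "convex_on UNIV \<phi>"
    and phi_diff: "\<And>u. \<phi> differentiable at u"
    and M_pos: "0 < M"
    and dloss_bound: "\<And>\<zeta> y. y \<in> {-1, 1} \<Longrightarrow> \<bar>dloss \<phi> \<zeta> y\<bar> \<le> M"
    and L_pos: "0 < L"
    and smooth: "\<And>g h. \<bar>risk \<phi> \<rho> (eval_at (g + h)) - risk \<phi> \<rho> (eval_at g)
                    - inner (gradient (\<lambda>f. risk \<phi> \<rho> (eval_at f)) g) h\<bar> \<le> L / 2 * (norm h)\<^sup>2"
    and supp: "measure_support (marginal A \<rho>) = UNIV"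
    and R_pos: "0 < R"
    and k_bound: "\<And>x. k x x \<le> R\<^sup>2"
    and delta: "\<delta> \<in> {0<..<1/2}"
    and noise: "AE x in marginal A \<rho>. \<bar>measure (\<kappa> x) {1} - 1/2\<bar> > \<delta>"
    and cond_interior: "AE x in marginal A \<rho>. measure (\<kappa> x) {1} \<in> {0<..<1}"
    and link_wd: "link_well_defined \<phi>"
    and link_diff: "\<And>\<mu>. \<mu> \<in> {0<..<1} \<Longrightarrow> link \<phi> differentiable at \<mu>"
    and link_mono: "mono_on {0<..<1} (link \<phi>)"
    and link_inj: "inj_on (link \<phi>) {0<..<1}"
    and link_sgn: "\<And>\<mu>. \<mu> \<in> {0<..<1} \<Longrightarrow> sgn (\<mu> - 1/2) = sgn (link \<phi> \<mu>)"
    and bregman_pos: "\<And>a b. a \<in> {0<..<1} \<Longrightarrow> b \<in> {0<..<1} \<Longrightarrow>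
                        bregman (min_cond_risk \<phi>) a b = 0 \<longleftrightarrow> a = b"
    and bayes: "\<exists>gs. bayes_rule A \<phi> \<rho> (eval_at gs) \<and>
                  (\<forall>f. bayes_rule A \<phi> \<rho> f \<longrightarrow> (AE x in marginal A \<rho>. f x = eval_at gs x))"
  shows "\<exists>lam>0. \<forall>\<gamma> \<sigma> g1 \<nu>.
      0 < \<gamma> \<longrightarrow>
      step_size lam \<gamma> 1 \<le> min (1 / (L + lam)) (1 / (2 * lam)) \<longrightarrow>
      0 < \<sigma>\<^sup>2 \<longrightarrow>
      (\<forall>g. (\<integral>z. (norm (stoch_grad \<phi> eval_at k g z - gradient (\<lambda>f. risk \<phi> \<rho> (eval_at f)) g))\<^sup>2 \<partial>\<rho>) \<le> \<sigma>\<^sup>2) \<longrightarrow>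
      norm g1 \<le> (2 * step_size lam \<gamma> 1 + 1 / lam) * M * R \<longrightarrow>
      \<nu> = max (2 / lam\<^sup>2 * (L + lam) * \<sigma>\<^sup>2)
              ((1 + \<gamma>) * (reg_risk \<phi> \<rho> eval_at lam g1
                 - reg_risk \<phi> \<rho> eval_at lam (arg_min (reg_risk \<phi> \<rho> eval_at lam) (\<lambda>_. True)))) \<longrightarrow>
      (\<forall>T::nat. real T \<ge> 32 * R\<^sup>2 * \<nu> / ((margin \<phi> \<delta>)\<^sup>2 * lam) - \<gamma> \<longrightarrow>
        (\<integral>z. (class_error \<rho> (eval_at (sgd \<phi> eval_at k lam (step_size lam \<gamma>) g1 z T))
               - class_error \<rho> (\<lambda>x. \<integral>y. y \<partial>\<kappa> x)) \<partial>(\<Pi>\<^sub>M t\<in>{1..T}. \<rho>))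
        \<le> 2 * exp (- ((margin \<phi> \<delta>)\<^sup>2 * lam\<^sup>2 * (\<gamma> + real T) / (2 ^ 9 * 9 * M\<^sup>2 * R ^ 4))))"
proof -
  interpret prob_space \<rho> by (rule prob)
  interpret binary_classification A k eval_at \<rho> \<phi> M L R \<kappa> \<delta>
    by unfold_locales (fact assms)+
  define m where "m = margin \<phi> \<delta>"
  have m: "0 < m"
    unfolding m_def by (rule margin_pos)
  \<comment> \<open>Half of the admissible radius \<open>m / R\<close> is for the distance from
    \<open>gm\<close> to \<open>gl\<close>, half for the deviation of the iterate from
    \<open>gm\<close>.\<close>
  define \<epsilon> where "\<epsilon> = m / (2 * R)"
  have \<epsilon>: "0 < \<epsilon>"
    using m R_pos by (simp add: \<epsilon>_def)
  obtain gs where min: "\<And>h. rsk gs \<le> rsk h"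
    and link: "\<And>g. rsk g = rsk gs \<Longrightarrow> AE x in marginal A \<rho>. eval_at g x = link \<phi> (posterior x)"
    using risk_minimizer_is_link by blast
  obtain gl where gl: "rsk gl = rsk gs"
    and path: "\<And>e. 0 < e \<Longrightarrow> \<exists>lam>0. \<exists>g. grad g + lam *\<^sub>R g = 0 \<and> norm (g - gl) < e"
    using tikhonov_limit[OF min] by metis
  obtain lam gm where lam: "0 < lam" and gm: "grad gm + lam *\<^sub>R gm = 0" and near: "norm (gm - gl) < \<epsilon>"
    using path[OF \<epsilon>] by blast
  have deviation: "(\<integral>z. (class_error \<rho> (eval_at (sgd \<phi> eval_at k lam (step_size lam \<gamma>) g1 z T))
               - class_error \<rho> (\<lambda>x. \<integral>y. y \<partial>\<kappa> x)) \<partial>(\<Pi>\<^sub>M t\<in>{1..T}. \<rho>))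
        \<le> 2 * exp (- (m\<^sup>2 * lam\<^sup>2 * (\<gamma> + real T) / (2 ^ 9 * 9 * M\<^sup>2 * R ^ 4)))"
    if gam: "0 < \<gamma>" and eta1: "step_size lam \<gamma> 1 \<le> min (1 / (L + lam)) (1 / (2 * lam))"
      and nu: "(1 + \<gamma>) * (reg_risk \<phi> \<rho> eval_at lam g1
                 - reg_risk \<phi> \<rho> eval_at lam (arg_min (reg_risk \<phi> \<rho> eval_at lam) (\<lambda>_. True))) \<le> \<nu>"
      and T: "real T \<ge> 32 * R\<^sup>2 * \<nu> / (m\<^sup>2 * lam) - \<gamma>" for \<gamma> g1 \<nu> and T :: nat
  proof -
    define a where "a = \<gamma> + real T"
    have a: "0 < a" "\<gamma> \<le> a"
      using gam by (simp_all add: a_def)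
    define q where "q = norm (g1 - gm)"
    \<comment> \<open>The minimum is attained at \<open>gm\<close>, so the \<open>arg_min\<close>
      term is a genuine minimiser.\<close>
    have "reg_risk \<phi> \<rho> eval_at lam (arg_min (reg_risk \<phi> \<rho> eval_at lam) (\<lambda>_. True)) \<le> reg_risk \<phi> \<rho> eval_at lam gm"
    proof (rule arg_minI[where x = gm])
      show "\<not> reg_risk \<phi> \<rho> eval_at lam y < reg_risk \<phi> \<rho> eval_at lam gm" for y
      proof -
        have "0 \<le> lam / 2 * (norm (y - gm))\<^sup>2"
          using lam by simp
        then show ?thesis
          using regularized_stationary_le[OF gm, of y] by linarith
      qed
    qed (auto simp: not_less)
    then have "lam / 2 * q\<^sup>2 \<le> reg_risk \<phi> \<rho> eval_at lam g1
        - reg_risk \<phi> \<rho> eval_at lam (arg_min (reg_risk \<phi> \<rho> eval_at lam) (\<lambda>_. True))"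
      using regularized_stationary_le[OF gm, of g1] unfolding q_def by linarith
    then have "(1 + \<gamma>) * (lam / 2 * q\<^sup>2) \<le> \<nu>"
      using gam by (intro order_trans[OF mult_left_mono nu]) auto
    \<comment> \<open>The lower bound on \<open>T\<close> turns the initial excess risk into a bound
      on the distance \<open>q\<close>.\<close>
    then have "32 * R\<^sup>2 * ((1 + \<gamma>) * (lam / 2 * q\<^sup>2)) \<le> 32 * R\<^sup>2 * \<nu>"
      by (rule mult_left_mono) simp
    also have "32 * R\<^sup>2 * \<nu> \<le> a * (m\<^sup>2 * lam)"
      using T m lam by (simp add: a_def pos_divide_le_eq[symmetric])
    finally have "32 * R\<^sup>2 * ((1 + \<gamma>) * (lam / 2 * q\<^sup>2)) \<le> a * (m\<^sup>2 * lam)" .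
    then have "(16 * R\<^sup>2 * ((1 + \<gamma>) * q\<^sup>2)) * lam \<le> (a * m\<^sup>2) * lam"
      by (simp add: algebra_simps)
    then have q: "16 * R\<^sup>2 * ((1 + \<gamma>) * q\<^sup>2) \<le> a * m\<^sup>2"
      using lam by simp
    have "\<gamma>\<^sup>2 * (16 * R\<^sup>2 * q\<^sup>2) \<le> a * (16 * R\<^sup>2 * ((1 + \<gamma>) * q\<^sup>2))"
    proof -
      have "\<gamma>\<^sup>2 \<le> a * (1 + \<gamma>)"
        unfolding power2_eq_square using a gam by (intro mult_mono) auto
      then have "\<gamma>\<^sup>2 * (16 * R\<^sup>2 * q\<^sup>2) \<le> a * (1 + \<gamma>) * (16 * R\<^sup>2 * q\<^sup>2)"
        by (intro mult_right_mono) auto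
      then show ?thesis
        by (simp add: mult_ac)
    qed
    also have "\<dots> \<le> a * (a * m\<^sup>2)"
      using q a by (intro mult_left_mono) auto
    finally have "(4 * R * (\<gamma> * q))\<^sup>2 \<le> (a * m)\<^sup>2"
      by (simp add: power_mult_distrib power2_eq_square mult_ac)
    then have "4 * R * (\<gamma> * q) \<le> a * m"
      by (rule power2_le_imp_le) (use a m in simp)
    then have "\<gamma> * q \<le> a * m / (4 * R)"
      using R_pos by (simp only: pos_le_divide_eq mult_pos_pos zero_less_numeral mult.commute)
    then have "\<gamma> * q / a \<le> m / (4 * R)"
      using a(1) by (simp only: pos_divide_le_eq times_divide_eq_right mult.commute)
    then have start: "\<gamma> / (\<gamma> + real T) * norm (g1 - gm) \<le> \<epsilon> / 2"
      by (simp add: a_def q_def \<epsilon>_def)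
    have "(\<integral>z. (class_error \<rho> (eval_at (sgd \<phi> eval_at k lam (step_size lam \<gamma>) g1 z T))
               - class_error \<rho> (\<lambda>x. \<integral>y. y \<partial>\<kappa> x)) \<partial>(\<Pi>\<^sub>M t\<in>{1..T}. \<rho>))
        \<le> 2 * exp (- (\<epsilon>\<^sup>2 * lam\<^sup>2 * (\<gamma> + real T) / (128 * M\<^sup>2 * R\<^sup>2)))"
    proof (rule sgd_deviation[OF gm lam gam eta1 \<epsilon> start])
      fix z
      let ?g = "sgd \<phi> eval_at k lam (step_size lam \<gamma>) g1 z T"
      show "class_error \<rho> (eval_at ?g) - class_error \<rho> (\<lambda>x. \<integral>y. y \<partial>\<kappa> x) \<le> of_bool (\<epsilon> \<le> norm (?g - gm))"
      \<comment> \<open>Far from \<open>gm\<close> the excess error is at most \<open>1\<close>;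
        near it the signs are optimal and the excess error is \<open>0\<close>.\<close>
      proof (cases "\<epsilon> \<le> norm (?g - gm)")
        case True
        then show ?thesis
          using class_error_diff_le_1 by simp
      next
        case False
        have "norm (?g - gl) \<le> norm (?g - gm) + norm (gm - gl)"
          using norm_triangle_ineq[of "?g - gm" "gm - gl"] by simp
        also have "\<dots> < \<epsilon> + \<epsilon>"
          using False near by (intro add_strict_mono) auto
        also have "\<epsilon> + \<epsilon> = margin \<phi> \<delta> / R"
          by (simp add: \<epsilon>_def m_def)
        finally show ?thesis
          using class_error_optimal[OF link[OF gl]] by simp
      qed
    qed
    also have "\<dots> \<le> 2 * exp (- (m\<^sup>2 * lam\<^sup>2 * (\<gamma> + real T) / (2 ^ 9 * 9 * M\<^sup>2 * R ^ 4)))"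
    proof -
      \<comment> \<open>The decay rate obtained is nine times the required one.\<close>
      have "\<epsilon>\<^sup>2 * lam\<^sup>2 * (\<gamma> + real T) / (128 * M\<^sup>2 * R\<^sup>2) = m\<^sup>2 * lam\<^sup>2 * (\<gamma> + real T) / (2 ^ 9 * M\<^sup>2 * R ^ 4)"
        by (simp add: \<epsilon>_def power_divide power_mult_distrib power2_eq_square power4_eq_xxxx mult_ac)
      moreover have "m\<^sup>2 * lam\<^sup>2 * (\<gamma> + real T) / (2 ^ 9 * 9 * M\<^sup>2 * R ^ 4) \<le> m\<^sup>2 * lam\<^sup>2 * (\<gamma> + real T) / (2 ^ 9 * M\<^sup>2 * R ^ 4)"
        using gam M_pos R_pos by (intro divide_left_mono mult_right_mono mult_pos_pos) auto
      ultimately show ?thesis by simp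
    qed
    finally show ?thesis .
  qed
  show ?thesis
    unfolding m_def[symmetric]
  proof (intro exI[of _ lam] conjI lam allI impI)
    fix \<gamma> \<sigma> \<nu> :: real and g1 and T :: nat
    assume asm: "0 < \<gamma>" "step_size lam \<gamma> 1 \<le> min (1 / (L + lam)) (1 / (2 * lam))"
      and nu: "\<nu> = max (2 / lam\<^sup>2 * (L + lam) * \<sigma>\<^sup>2)
              ((1 + \<gamma>) * (reg_risk \<phi> \<rho> eval_at lam g1
                 - reg_risk \<phi> \<rho> eval_at lam (arg_min (reg_risk \<phi> \<rho> eval_at lam) (\<lambda>_. True))))"
      and T: "real T \<ge> 32 * R\<^sup>2 * \<nu> / (m\<^sup>2 * lam) - \<gamma>"
    show "(\<integral>z. (class_error \<rho> (eval_at (sgd \<phi> eval_at k lam (step_size lam \<gamma>) g1 z T))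
               - class_error \<rho> (\<lambda>x. \<integral>y. y \<partial>\<kappa> x)) \<partial>(\<Pi>\<^sub>M t\<in>{1..T}. \<rho>))
        \<le> 2 * exp (- (m\<^sup>2 * lam\<^sup>2 * (\<gamma> + real T) / (2 ^ 9 * 9 * M\<^sup>2 * R ^ 4)))"
      by (rule deviation[OF asm _ T]) (simp only: nu max.cobounded2)
  qed
qed

end
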